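(* Let $G$ be a group acting geometrically on a proper CAT(0) space $X$. If $X$ contains a sublinearly contracting geodesic ray, then $G$ contains a rank one isometry.
   Context: A sublinear function is a function $\kappa:[0,\infty)\to[1,\infty)$ that is monotone increasing, concave, and satisfies $\lim_{t\to\infty}\kappa(t)/t=0$. For a geodesic ray $b:[0,\infty)\to X$ let $\pi_b:X\to b$ denote the nearest point projection onto (the image of) $b$. The ray $b$ is $\kappa$-contracting if there is a constant $\mathsf{n}\ge 0$ such that for every ball $B$ centered at a point $x\in X$ with $B\cap b=\emptyset$ one has $\operatorname{diam}(\pi_b(B))\le \mathsf{n}\,\kappa(\|x\|)$, where $\|x\|=d(x,b(0))$. It is sublinearly contracting if it is $\kappa$-contracting for some sublinear function $\kappa$. Acting geometrically means acting properly discontinuously and cocompactly by isometries. A rank one isometry is (in the standard sense) a hyperbolic (axial) isometry of $X$ having an axis that does not bound an isometrically embedded flat Euclidean half-plane in $X$; "$G$ contains a rank one isometry" means some element of $G$ acts on $X$ as a rank one isometry. *)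

theory Defs
  imports "HOL-Analysis.Analysis" "HOL-Algebra.Group_Action"
begin

definition isometric_on :: "'a::metric_space set \<Rightarrow> ('a \<Rightarrow> 'b::metric_space) \<Rightarrow> bool" where
  "isometric_on S f \<longleftrightarrow> (\<forall>x\<in>S. \<forall>y\<in>S. dist (f x) (f y) = dist x y)"

definition geodesic_ray :: "(real \<Rightarrow> 'a::metric_space) \<Rightarrow> bool" where
  "geodesic_ray b \<longleftrightarrow> isometric_on {0..} b"

definition geodesic_line :: "(real \<Rightarrow> 'a::metric_space) \<Rightarrow> bool" where
  "geodesic_line l \<longleftrightarrow> isometric_on UNIV l"

definition geodesic_segment :: "'a::metric_space set \<Rightarrow> 'a \<Rightarrow> 'a \<Rightarrow> bool" where
  "geodesic_segment S p q \<longleftrightarrow>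
     (\<exists>c. isometric_on {0..dist p q} c \<and> c 0 = p \<and> c (dist p q) = q \<and> S = c ` {0..dist p q})"

definition geodesic_triangle ::
    "'a::metric_space \<Rightarrow> 'a \<Rightarrow> 'a \<Rightarrow> 'a set \<Rightarrow> 'a set \<Rightarrow> 'a set \<Rightarrow> bool" where
  "geodesic_triangle p q r A B C \<longleftrightarrow>
     geodesic_segment A p q \<and> geodesic_segment B q r \<and> geodesic_segment C r p"

definition comparison_triangle ::
    "'a::metric_space \<Rightarrow> 'a \<Rightarrow> 'a \<Rightarrow> real^2 \<Rightarrow> real^2 \<Rightarrow> real^2 \<Rightarrow> bool" where
  "comparison_triangle p q r p' q' r' \<longleftrightarrow>
     dist p' q' = dist p q \<and> dist q' r' = dist q r \<and> dist r' p' = dist r p"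

text \<open>
  A point of the triangle may lie on several sides and then has a comparison point for each of
  these sides. Hence this is a relation and not a function.
\<close>

definition comparison_point ::
    "'a::metric_space \<Rightarrow> 'a \<Rightarrow> 'a \<Rightarrow> 'a set \<Rightarrow> 'a set \<Rightarrow> 'a set \<Rightarrow>
     real^2 \<Rightarrow> real^2 \<Rightarrow> real^2 \<Rightarrow> 'a \<Rightarrow> real^2 \<Rightarrow> bool" where
  "comparison_point p q r A B C p' q' r' x x' \<longleftrightarrow>
     x \<in> A \<and> x' \<in> closed_segment p' q' \<and> dist p' x' = dist p x \<or>
     x \<in> B \<and> x' \<in> closed_segment q' r' \<and> dist q' x' = dist q x \<or>
     x \<in> C \<and> x' \<in> closed_segment r' p' \<and> dist r' x' = dist r x"

class cat0_space = metric_space +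
  assumes geodesic_exists: "\<exists>S. geodesic_segment S p q"
    and cat0_inequality:
      "geodesic_triangle p q r A B C \<Longrightarrow> comparison_triangle p q r p' q' r' \<Longrightarrow>
       comparison_point p q r A B C p' q' r' x x' \<Longrightarrow>
       comparison_point p q r A B C p' q' r' y y' \<Longrightarrow> dist x y \<le> dist x' y'"

class proper_metric_space = metric_space +
  assumes compact_cball_proper: "compact (cball x r)"

instance proper_metric_space \<subseteq> heine_borel
proof
  fix f :: "nat \<Rightarrow> 'a"
  assume "bounded (range f)"
  then obtain x r where "range f \<subseteq> cball x r"
    by (auto simp: bounded_subset_cball bounded_def subset_iff)
  moreover have "seq_compact (cball x r)"
    using compact_cball_proper compact_imp_seq_compact by blast
  ultimately show "\<exists>l r. strict_mono (r::nat\<Rightarrow>nat) \<and> ((f \<circ> r) \<longlongrightarrow> l) sequentially"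
    unfolding seq_compact_def by (metis range_subsetD)
qed

text \<open>
  Only the values on \<open>[0, \<infinity>)\<close> matter. Increasing is meant in the weak sense, so that constant
  functions are sublinear.
\<close>

definition sublinear :: "(real \<Rightarrow> real) \<Rightarrow> bool" where
  "sublinear \<kappa> \<longleftrightarrow>
     (\<forall>t\<ge>0. 1 \<le> \<kappa> t) \<and> mono_on {0..} \<kappa> \<and> concave_on {0..} \<kappa> \<and>
     ((\<lambda>t. \<kappa> t / t) \<longlongrightarrow> 0) at_top"

text \<open>
  The counterpart of \<^const>\<open>closest_point\<close>, which is restricted to inner product spaces. In a
  CAT(0) space the closest point on the image of a geodesic ray exists and is unique.
\<close>

definition nearest_point :: "'a::metric_space set \<Rightarrow> 'a \<Rightarrow> 'a" where
  "nearest_point S x = (SOME y. y \<in> S \<and> (\<forall>z\<in>S. dist x y \<le> dist x z))"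

definition kappa_contracting :: "(real \<Rightarrow> real) \<Rightarrow> (real \<Rightarrow> 'a::metric_space) \<Rightarrow> bool" where
  "kappa_contracting \<kappa> b \<longleftrightarrow>
     (\<exists>n\<ge>0. \<forall>x r. ball x r \<inter> b ` {0..} = {} \<longrightarrow>
        diameter (nearest_point (b ` {0..}) ` ball x r) \<le> n * \<kappa> (dist x (b 0)))"

definition sublinearly_contracting :: "(real \<Rightarrow> 'a::metric_space) \<Rightarrow> bool" where
  "sublinearly_contracting b \<longleftrightarrow> (\<exists>\<kappa>. sublinear \<kappa> \<and> kappa_contracting \<kappa> b)"

definition translation_length :: "('a::metric_space \<Rightarrow> 'a) \<Rightarrow> real" where
  "translation_length g = (INF x. dist x (g x))"

definition hyperbolic_isometry :: "('a::metric_space \<Rightarrow> 'a) \<Rightarrow> bool" where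
  "hyperbolic_isometry g \<longleftrightarrow>
     isometric_on UNIV g \<and> surj g \<and> 0 < translation_length g \<and>
     (\<exists>x. dist x (g x) = translation_length g)"

definition axis_of :: "('a::metric_space \<Rightarrow> 'a) \<Rightarrow> (real \<Rightarrow> 'a) \<Rightarrow> bool" where
  "axis_of g l \<longleftrightarrow> geodesic_line l \<and> (\<exists>a. a \<noteq> 0 \<and> (\<forall>t. g (l t) = l (t + a)))"

definition bounds_flat_half_plane :: "(real \<Rightarrow> 'a::metric_space) \<Rightarrow> bool" where
  "bounds_flat_half_plane l \<longleftrightarrow>
     (\<exists>f :: real^2 \<Rightarrow> 'a. isometric_on {v. 0 \<le> v $ 2} f \<and> f ` {v. v $ 2 = 0} = range l)"

definition rank_one_isometry :: "('a::metric_space \<Rightarrow> 'a) \<Rightarrow> bool" where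
  "rank_one_isometry g \<longleftrightarrow>
     hyperbolic_isometry g \<and> (\<exists>l. axis_of g l \<and> \<not> bounds_flat_half_plane l)"

definition properly_discontinuous ::
    "('g, 'm) monoid_scheme \<Rightarrow> ('g \<Rightarrow> 'a::metric_space \<Rightarrow> 'a) \<Rightarrow> bool" where
  "properly_discontinuous G \<phi> \<longleftrightarrow>
     (\<forall>K. compact K \<longrightarrow> finite {g \<in> carrier G. \<phi> g ` K \<inter> K \<noteq> {}})"

definition cocompact ::
    "('g, 'm) monoid_scheme \<Rightarrow> ('g \<Rightarrow> 'a::metric_space \<Rightarrow> 'a) \<Rightarrow> bool" where
  "cocompact G \<phi> \<longleftrightarrow> (\<exists>K. compact K \<and> (\<Union>g\<in>carrier G. \<phi> g ` K) = UNIV)"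

definition acts_geometrically ::
    "('g, 'm) monoid_scheme \<Rightarrow> ('g \<Rightarrow> 'a::metric_space \<Rightarrow> 'a) \<Rightarrow> bool" where
  "acts_geometrically G \<phi> \<longleftrightarrow>
     group_action G UNIV \<phi> \<and> (\<forall>g\<in>carrier G. isometric_on UNIV (\<phi> g)) \<and>
     properly_discontinuous G \<phi> \<and> cocompact G \<phi>"

end

theory Submission
  imports Defs
begin

text \<open>
  Far out along a sublinearly contracting ray \<open>b\<close>, the contraction constant at scale \<open>L\<close> is
  \<open>o(L)\<close>, so the initial piece of length \<open>L\<close> looks from nearby like a segment in a tree, up to
  an error \<open>\<epsilon> * L\<close>. By Stewart's inequality this remains true for arbitrarily distant
  observers, since a nearly geodesic corner \<open>w, p, q\<close> stays nearly geodesic, with the same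
  error, when \<open>[p, q]\<close> is prolonged. Hence a geodesic joining two points on different sides of a
  subpiece passes near that subpiece.

  By cocompactness some group element moves \<open>b 0\<close> close to \<open>b t\<close>. Unless it folds \<open>b\<close> back along
  itself at \<open>b t\<close>, it maps a half-space into a deeper one; and if two such elements fold, their
  quotient shifts a piece of \<open>b\<close>. So there is an element nesting half-spaces. Its orbits cross
  the tree-like piece from one side to the other, whence it has no fixed point and each of its axes
  passes near the piece. The axis cannot bound a flat half-plane, because a point high above it
  would see the piece at almost constant distance.
\<close>

section \<open>Comparison inequalities\<close>

text \<open>Put \<open>p'\<close> at the origin and \<open>q'\<close> at \<open>(c, 0)\<close>. The
  law of cosines dictates the first coordinate \<open>x\<close> of \<open>r'\<close>; the triangle
  inequalities bound it by \<open>b\<close>, so the second coordinate is real.\<close>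

lemma comparison_triangle_exists:
  fixes p q r :: "'a::metric_space"
  shows "\<exists>p' q' r'. comparison_triangle p q r p' q' r'"
proof -
  define a b c where abc: "a = dist q r" "b = dist r p" "c = dist p q"
  have tri: "a \<le> b + c" "b \<le> a + c" "c \<le> a + b" "0 \<le> a" "0 \<le> b" "0 \<le> c"
    using dist_triangle[of q r p] dist_triangle[of r p q] dist_triangle[of p q r]
    by (auto simp: abc dist_commute)
  define x where "x = (if c = 0 then b else (b\<^sup>2 + c\<^sup>2 - a\<^sup>2) / (2 * c))"
  have ax: "b\<^sup>2 + c\<^sup>2 - 2 * c * x = a\<^sup>2"
    using tri by (auto simp: x_def field_simps)
  have xb: "x\<^sup>2 \<le> b\<^sup>2"
  proof (cases "c = 0")
    case False
    then have c: "c > 0" using tri by simp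
    have "(b - c)\<^sup>2 \<le> a\<^sup>2"
      using tri by (intro abs_le_square_iff[THEN iffD1]) (auto simp: abs_le_iff)
    then have "- (2 * c * b) \<le> - (2 * c * x)"
      using ax by (simp add: power2_eq_square algebra_simps)
    then have "x \<le> b" using c by simp
    have "a\<^sup>2 \<le> (b + c)\<^sup>2"
      using tri by (intro power_mono) auto
    then have "2 * c * (- b) \<le> 2 * c * x"
      using ax by (simp add: power2_eq_square algebra_simps)
    then have "- b \<le> x" using c by (simp only: mult_le_cancel_left_pos)
    show ?thesis
      using \<open>x \<le> b\<close> \<open>- b \<le> x\<close> tri by (intro abs_le_square_iff[THEN iffD1]) auto
  qed (auto simp: x_def)
  have "dist (vector [0, 0] :: real^2) (vector [c, 0]) = c"
    using tri by (simp add: dist_vec_def L2_set_def sum_2 dist_real_def)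
  moreover have "dist (vector [c, 0] :: real^2) (vector [x, sqrt (b\<^sup>2 - x\<^sup>2)]) = a"
  proof -
    have "(c - x)\<^sup>2 + (b\<^sup>2 - x\<^sup>2) = a\<^sup>2"
      using ax by (simp add: power2_eq_square algebra_simps)
    then show ?thesis
      using tri xb by (simp add: dist_vec_def L2_set_def sum_2 dist_real_def)
  qed
  moreover have "dist (vector [x, sqrt (b\<^sup>2 - x\<^sup>2)] :: real^2) (vector [0, 0]) = b"
    using tri xb by (simp add: dist_vec_def L2_set_def sum_2 dist_real_def)
  ultimately show ?thesis
    unfolding comparison_triangle_def abc by metis
qed

lemma stewart_euclidean:
  fixes p q w :: "'a::real_inner"
  shows "(dist w ((1 - u) *\<^sub>R p + u *\<^sub>R q))\<^sup>2 =
    (1 - u) * (dist w p)\<^sup>2 + u * (dist w q)\<^sup>2 - u * (1 - u) * (dist p q)\<^sup>2"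
  by (simp add: dist_norm power2_norm_eq_inner inner_simps inner_commute algebra_simps)

text \<open>Only the vertex \<open>w\<close> and the point \<open>m\<close> of the opposite side are
  compared; in the plane Stewart's theorem is an equality.\<close>

lemma stewart_segment:
  fixes p q w :: "'a::cat0_space"
  assumes "geodesic_segment S p q" "m \<in> S"
    and m: "dist p m = u * dist p q" "0 \<le> u" "u \<le> 1"
  shows "(dist w m)\<^sup>2 \<le>
    (1 - u) * (dist w p)\<^sup>2 + u * (dist w q)\<^sup>2 - u * (1 - u) * (dist p q)\<^sup>2"
proof -
  obtain B C where "geodesic_segment B q w" "geodesic_segment C w p"
    using geodesic_exists by blast
  then have tri: "geodesic_triangle p q w S B C"
    using assms by (simp add: geodesic_triangle_def)
  obtain p' q' w' where cmp: "comparison_triangle p q w p' q' w'"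
    using comparison_triangle_exists by blast
  then have d: "dist p' q' = dist p q" "dist q' w' = dist q w" "dist w' p' = dist w p"
    by (auto simp: comparison_triangle_def)
  define m' where "m' = (1 - u) *\<^sub>R p' + u *\<^sub>R q'"
  have "m' \<in> closed_segment p' q'"
    using m by (auto simp: m'_def closed_segment_def)
  moreover have "dist p' m' = dist p m"
  proof -
    have "p' - m' = u *\<^sub>R (p' - q')" by (simp add: m'_def algebra_simps)
    then show ?thesis using m d by (simp add: dist_norm)
  qed
  ultimately have cm: "comparison_point p q w S B C p' q' w' m m'"
    using assms by (simp add: comparison_point_def)
  obtain c where c: "c 0 = w" "C = c ` {0..dist w p}"
    using \<open>geodesic_segment C w p\<close> by (auto simp: geodesic_segment_def)
  have "w \<in> C"
    unfolding c(2) using c(1) by (intro image_eqI[of _ _ 0]) auto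
  then have cw: "comparison_point p q w S B C p' q' w' w w'"
    by (simp add: comparison_point_def)
  have "(dist w m)\<^sup>2 \<le> (dist w' m')\<^sup>2"
    using cat0_inequality[OF tri cmp cw cm] by (intro power_mono) auto
  also have "\<dots> = (1 - u) * (dist w p)\<^sup>2 + u * (dist w q)\<^sup>2 - u * (1 - u) * (dist p q)\<^sup>2"
    using d by (simp add: m'_def stewart_euclidean dist_commute)
  finally show ?thesis .
qed

lemma geodesic_path_exists:
  fixes p q :: "'a::cat0_space"
  obtains c where "isometric_on {0..dist p q} c" "c 0 = p" "c (dist p q) = q"
    "geodesic_segment (c ` {0..dist p q}) p q"
  using geodesic_exists[of p q] unfolding geodesic_segment_def by metis

lemma between_exists:
  fixes p q :: "'a::cat0_space"
  assumes "0 \<le> t" "t \<le> dist p q"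
  obtains m S where "geodesic_segment S p q" "m \<in> S" "dist p m = t" "dist m q = dist p q - t"
proof -
  obtain c where c: "isometric_on {0..dist p q} c" "c 0 = p" "c (dist p q) = q"
    "geodesic_segment (c ` {0..dist p q}) p q"
    by (rule geodesic_path_exists)
  have "dist (c 0) (c t) = t" "dist (c t) (c (dist p q)) = dist p q - t"
    using c(1) assms by (auto simp: isometric_on_def dist_real_def)
  then show ?thesis
    using that[OF c(4), of "c t"] assms c(2,3) by auto
qed

text \<open>
  Any metrically intermediate point lies on the chosen segment, because the inequality for the
  point of that segment at the same distance forces both to agree.
\<close>

lemma stewart:
  fixes p q w m :: "'a::cat0_space"
  assumes m: "dist p m = u * dist p q" "dist m q = (1 - u) * dist p q" "0 \<le> u" "u \<le> 1"
  shows "(dist w m)\<^sup>2 \<le>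
    (1 - u) * (dist w p)\<^sup>2 + u * (dist w q)\<^sup>2 - u * (1 - u) * (dist p q)\<^sup>2"
proof -
  have "u * dist p q \<le> dist p q"
    using m by (intro mult_left_le_one_le) auto
  then obtain n S where n: "geodesic_segment S p q" "n \<in> S" "dist p n = u * dist p q"
    using between_exists[of "u * dist p q" p q] m by (metis mult_nonneg_nonneg zero_le_dist)
  have "(dist m n)\<^sup>2 \<le>
      (1 - u) * (dist m p)\<^sup>2 + u * (dist m q)\<^sup>2 - u * (1 - u) * (dist p q)\<^sup>2"
    using stewart_segment[OF n m(3,4)] .
  also have "\<dots> = 0"
    unfolding dist_commute[of m p] m(1,2) by (simp add: power2_eq_square algebra_simps)
  finally have "m = n" by simp
  then show ?thesis
    using stewart_segment[OF n m(3,4)] by simp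
qed

lemma midpoint_ineq:
  fixes p q w m :: "'a::cat0_space"
  assumes "dist p m = dist p q / 2" "dist m q = dist p q / 2"
  shows "(dist w m)\<^sup>2 \<le> (dist w p)\<^sup>2 / 2 + (dist w q)\<^sup>2 / 2 - (dist p q)\<^sup>2 / 4"
  using stewart[of p m "1/2" q w] assms by simp

lemma midpoint_exists:
  fixes p q :: "'a::cat0_space"
  obtains m where "dist p m = dist p q / 2" "dist m q = dist p q / 2"
  using between_exists[of "dist p q / 2" p q] by auto

text \<open>Two uses of the midpoint inequality: \<open>dist m n\<close> is bounded through
  \<open>dist m r\<close>, and the terms in \<open>dist p q\<close> and \<open>dist q r\<close>
  cancel.\<close>

lemma midpoint_line:
  fixes p q r m n :: "'a::cat0_space"
  assumes m: "dist p m = dist p q / 2" "dist m q = dist p q / 2"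
    and n: "dist q n = dist q r / 2" "dist n r = dist q r / 2"
  shows "dist m n \<le> dist p r / 2"
proof -
  have "(dist m n)\<^sup>2 \<le> (dist m q)\<^sup>2 / 2 + (dist m r)\<^sup>2 / 2 - (dist q r)\<^sup>2 / 4"
    by (rule midpoint_ineq[OF n])
  moreover have "(dist r m)\<^sup>2 \<le> (dist r p)\<^sup>2 / 2 + (dist r q)\<^sup>2 / 2 - (dist p q)\<^sup>2 / 4"
    by (rule midpoint_ineq[OF m])
  ultimately have "(dist m n)\<^sup>2 \<le> (dist p r / 2)\<^sup>2"
    unfolding m by (simp add: dist_commute power2_eq_square field_simps)
  then show ?thesis
    by (rule power2_le_imp_le) simp
qed

text \<open>
  A path from \<open>w\<close> to \<open>z\<close> through \<open>p\<close> which is nearly geodesic up to the point \<open>q\<close> of \<open>[p, z]\<close>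
  is nearly geodesic altogether, with an error that does not depend on the distance to \<open>z\<close>.
\<close>

lemma almost_geodesic_extend:
  fixes p q w z :: "'a::cat0_space"
  assumes q: "dist p q = r" "dist p q + dist q z = dist p z" "0 < r"
    and e: "0 \<le> e" "e \<le> r" and w: "dist w p + r - e \<le> dist w q"
  shows "dist w p + dist p z - 2 * e * (1 + dist w p / r) \<le> dist w z"
proof -
  define A D where AD: "A = dist p z" "D = dist w p"
  have A: "r \<le> A" "0 < A" and D: "0 \<le> D"
    using q zero_le_dist[of q z] zero_le_dist[of w p] unfolding AD by linarith+
  define u where "u = r / A"
  have u: "0 < u" "u \<le> 1" "u * A = r"
    using q A by (auto simp: u_def)
  have "(dist w q)\<^sup>2 \<le> (1 - u) * D\<^sup>2 + u * (dist w z)\<^sup>2 - u * (1 - u) * A\<^sup>2"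
    unfolding AD by (rule stewart) (use q u in \<open>auto simp: AD algebra_simps\<close>)
  moreover have "(D + r - e)\<^sup>2 \<le> (dist w q)\<^sup>2"
    using w D e unfolding AD by (intro power_mono) linarith+
  moreover have "(D + r)\<^sup>2 - 2 * e * (D + r) \<le> (D + r - e)\<^sup>2"
    by (simp add: power2_eq_square algebra_simps)
  ultimately have "(D + u * A)\<^sup>2 - 2 * e * (D + u * A) \<le>
      (1 - u) * D\<^sup>2 + u * (dist w z)\<^sup>2 - u * (1 - u) * A\<^sup>2"
    unfolding u(3) by linarith
  then have "u * (D + A)\<^sup>2 \<le> u * (dist w z)\<^sup>2 + 2 * e * (D + u * A)"
    by (simp add: power2_eq_square algebra_simps)
  moreover have "u * ((dist w z)\<^sup>2 + 2 * e * (D + r) / u) =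
      u * (dist w z)\<^sup>2 + 2 * e * (D + r)"
    using u(1) by (simp add: field_simps)
  ultimately have "u * (D + A)\<^sup>2 \<le> u * ((dist w z)\<^sup>2 + 2 * e * (D + r) / u)"
    unfolding u(3) by linarith
  then have main: "(D + A)\<^sup>2 \<le> (dist w z)\<^sup>2 + 2 * e * (D + r) / u"
    using u by (simp only: mult_le_cancel_left_pos)
  define X where "X = 2 * e * (D + r) / r"
  have X: "0 \<le> X" "2 * e * (D + r) / u = X * A"
    using e D q A by (auto simp: X_def u_def)
  \<comment> \<open>Division by \<open>u\<close> made the error grow linearly in \<open>A\<close>.
    Bounding it by a multiple of \<open>D + A\<close> lets one such factor cancel and leaves
    \<open>X\<close>, which does not depend on \<open>A\<close>.\<close>
  have "X * A \<le> X * (D + A)"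
    using X D by (simp add: mult_left_mono)
  then have main: "(D + A)\<^sup>2 \<le> (dist w z)\<^sup>2 + X * (D + A)"
    using main X by simp
  have "D + A - X \<le> dist w z"
  proof (rule ccontr)
    assume c: "\<not> ?thesis"
    then have "(dist w z)\<^sup>2 < (D + A - X)\<^sup>2"
      by (intro power_strict_mono) auto
    also have "\<dots> \<le> (D + A - X) * (D + A)"
      unfolding power2_eq_square using X c zero_le_dist[of w z]
      by (intro mult_left_mono) linarith+
    finally show False
      using main by (simp add: power2_eq_square algebra_simps)
  qed
  then show ?thesis
    using q by (simp add: X_def AD field_simps)
qed

text \<open>Passing to the midpoint of \<open>m\<close> and \<open>n\<close> lowers the squared
  bounds on the distances to \<open>y\<close> and \<open>p\<close> by a quarter of the square of
  \<open>dist m n\<close>. As \<open>R1 + R2\<close> exceeds \<open>dist y p\<close> by at most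
  \<open>k\<close>, this drop must be small.\<close>

lemma almost_between_close:
  fixes y p m n :: "'a::cat0_space"
  assumes "dist m y \<le> R1" "dist n y \<le> R1" "dist m p \<le> R2" "dist n p \<le> R2"
    and k: "R1 + R2 \<le> dist y p + k"
  shows "(dist m n)\<^sup>2 \<le> 8 * k * R2"
proof -
  obtain x where x: "dist m x = dist m n / 2" "dist x n = dist m n / 2"
    by (rule midpoint_exists)
  have sq: "(dist m y)\<^sup>2 \<le> R1\<^sup>2" "(dist n y)\<^sup>2 \<le> R1\<^sup>2" "(dist m p)\<^sup>2 \<le> R2\<^sup>2" "(dist n p)\<^sup>2 \<le> R2\<^sup>2"
    using assms by (auto intro!: power_mono)
  have R: "0 \<le> R1" "0 \<le> R2"
    using assms zero_le_dist order_trans by blast+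
  have y: "(dist y x)\<^sup>2 \<le> R1\<^sup>2 - (dist m n)\<^sup>2 / 4"
    using midpoint_ineq[OF x, of y] sq by (simp add: dist_commute)
  have p: "(dist p x)\<^sup>2 \<le> R2\<^sup>2 - (dist m n)\<^sup>2 / 4"
    using midpoint_ineq[OF x, of p] sq by (simp add: dist_commute)
  have "dist y x \<le> R1"
    using y R zero_le_power2[of "dist m n"] by - (rule power2_le_imp_le, linarith+)
  then have "R2 - k \<le> dist p x"
    using k dist_triangle[of y p x] by (simp add: dist_commute)
  moreover have "k \<ge> 0 \<Longrightarrow> (R2 - k)\<^sup>2 \<ge> R2\<^sup>2 - 2 * k * R2"
    by (simp add: power2_eq_square algebra_simps)
  moreover have "0 \<le> k"
    using assms dist_triangle[of y p m] by (simp add: dist_commute)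
  ultimately have "R2\<^sup>2 - 2 * k * R2 \<le> (dist p x)\<^sup>2"
  proof (cases "k \<le> R2")
    case True
    then have "(R2 - k)\<^sup>2 \<le> (dist p x)\<^sup>2"
      using \<open>R2 - k \<le> dist p x\<close> by (intro power_mono) auto
    moreover have "(R2 - k)\<^sup>2 = R2\<^sup>2 - 2 * k * R2 + k\<^sup>2"
      by (simp add: power2_eq_square algebra_simps)
    ultimately show ?thesis
      using zero_le_power2[of k] by linarith
  next
    case False
    then have "R2 * R2 \<le> k * R2" using R by (intro mult_right_mono) auto
    moreover have "0 \<le> k * R2" using \<open>0 \<le> k\<close> R by simp
    ultimately show ?thesis
      using zero_le_power2[of "dist p x"] unfolding power2_eq_square by linarith
  qed
  then show ?thesis using p by simp
qed

section \<open>Projection to a geodesic ray\<close>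

text \<open>Parameters turn projections into real numbers, to which the intermediate value theorem
  applies. \<open>THE\<close> is justified because a ray is injective.\<close>

definition ray_time :: "(real \<Rightarrow> 'a::metric_space) \<Rightarrow> 'a \<Rightarrow> real" where
  "ray_time b z = (THE t. 0 \<le> t \<and> b t = nearest_point (b ` {0..}) z)"

context
  fixes b :: "real \<Rightarrow> 'a::{cat0_space, proper_metric_space}"
  assumes ray: "geodesic_ray b"
begin

lemma dist_ray: "0 \<le> s \<Longrightarrow> 0 \<le> t \<Longrightarrow> dist (b s) (b t) = \<bar>s - t\<bar>"
  using ray by (auto simp: geodesic_ray_def isometric_on_def dist_real_def)

lemma continuous_on_ray: "continuous_on {0..} b"
  unfolding continuous_on_iff by (metis dist_ray atLeast_iff dist_real_def)

lemma nearest_point_ray: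
  "nearest_point (b ` {0..}) z \<in> b ` {0..} \<and>
    (\<forall>y\<in>b ` {0..}. dist z (nearest_point (b ` {0..}) z) \<le> dist z y)"
proof -
  \<comment> \<open>Beyond parameter \<open>R\<close> the ray is farther from \<open>z\<close> than
    \<open>b 0\<close> is, so a minimum over a compact interval suffices.\<close>
  define R where "R = 2 * dist z (b 0)"
  have "R \<ge> 0" by (simp add: R_def)
  have "continuous_on {0..R} (\<lambda>t. dist z (b t))"
    by (intro continuous_intros continuous_on_subset[OF continuous_on_ray]) auto
  then obtain t where t: "t \<in> {0..R}" "\<forall>s\<in>{0..R}. dist z (b t) \<le> dist z (b s)"
    using continuous_attains_inf[of "{0..R}" "\<lambda>t. dist z (b t)"] \<open>R \<ge> 0\<close> by auto
  have "dist z (b t) \<le> dist z (b s)" if "s \<ge> 0" for s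
  proof (cases "s \<le> R")
    case False
    have "dist z (b t) \<le> dist z (b 0)" using t \<open>R \<ge> 0\<close> by auto
    moreover have "s \<le> dist z (b 0) + dist z (b s)"
      using dist_ray[of s 0] that dist_triangle[of "b s" "b 0" z] by (simp add: dist_commute)
    ultimately show ?thesis using False unfolding R_def by linarith
  qed (use t that in auto)
  then have "\<exists>y. y \<in> b ` {0..} \<and> (\<forall>x\<in>b ` {0..}. dist z y \<le> dist z x)"
    using t by (intro exI[of _ "b t"]) auto
  then show ?thesis
    unfolding nearest_point_def by (rule someI_ex)
qed

lemma ray_time:
  "0 \<le> ray_time b z" "b (ray_time b z) = nearest_point (b ` {0..}) z"
proof -
  obtain t where t: "0 \<le> t" "b t = nearest_point (b ` {0..}) z"
    using nearest_point_ray[of z] by auto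
  have "\<And>s. 0 \<le> s \<Longrightarrow> b s = b t \<Longrightarrow> s = t"
    using dist_ray t(1) by (metis abs_eq_0 dist_self eq_iff_diff_eq_0)
  then have "ray_time b z = t"
    unfolding ray_time_def t(2)[symmetric] using t(1) by (intro the_equality) auto
  then show "0 \<le> ray_time b z" "b (ray_time b z) = nearest_point (b ` {0..}) z"
    using t by auto
qed

lemma dist_ray_time_le: "0 \<le> s \<Longrightarrow> dist z (b (ray_time b z)) \<le> dist z (b s)"
  using nearest_point_ray[of z] by (simp add: ray_time(2))

text \<open>Compare the projection with the midpoint between it and \<open>b s\<close>. The factor
  1/4 is weaker than in Pythagoras' theorem but enough for uniqueness and continuity.\<close>

lemma ray_time_pythagoras:
  assumes "0 \<le> s"
  shows "(dist z (b (ray_time b z)))\<^sup>2 + (s - ray_time b z)\<^sup>2 / 4 \<le> (dist z (b s))\<^sup>2"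
proof -
  define t where "t = ray_time b z"
  have t: "0 \<le> t" by (simp add: t_def ray_time)
  define m where "m = (s + t) / 2"
  have "dist (b s) (b m) = dist (b s) (b t) / 2" "dist (b m) (b t) = dist (b s) (b t) / 2"
    using t assms by (auto simp: dist_ray m_def abs_if field_simps)
  then have "(dist z (b m))\<^sup>2 \<le>
      (dist z (b s))\<^sup>2 / 2 + (dist z (b t))\<^sup>2 / 2 - (dist (b s) (b t))\<^sup>2 / 4"
    by (rule midpoint_ineq)
  moreover have "(dist z (b t))\<^sup>2 \<le> (dist z (b m))\<^sup>2"
    unfolding t_def by (intro power_mono dist_ray_time_le) (use t assms in \<open>auto simp: m_def t_def\<close>)
  moreover have "(dist (b s) (b t))\<^sup>2 = (s - t)\<^sup>2"
    using t assms by (simp add: dist_ray)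
  ultimately show ?thesis
    using zero_le_power2[of "s - t"] unfolding t_def[symmetric] by linarith
qed

lemma ray_time_unique:
  assumes "0 \<le> s" "dist z (b s) \<le> dist z (b (ray_time b z))"
  shows "ray_time b z = s"
proof -
  have "(dist z (b s))\<^sup>2 \<le> (dist z (b (ray_time b z)))\<^sup>2"
    using assms by (intro power_mono) auto
  then have "(s - ray_time b z)\<^sup>2 \<le> 0"
    using ray_time_pythagoras[OF assms(1), of z] by linarith
  then show ?thesis by simp
qed

lemma ray_time_self: "0 \<le> s \<Longrightarrow> ray_time b (b s) = s"
  by (rule ray_time_unique) simp_all

lemma ray_time_between:
  assumes "dist (b (ray_time b z)) v + dist v z = dist (b (ray_time b z)) z"
  shows "ray_time b v = ray_time b z"
proof -
  have "dist z (b (ray_time b v)) \<le> dist z v + dist v (b (ray_time b v))"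
    by (rule dist_triangle)
  also have "\<dots> \<le> dist z v + dist v (b (ray_time b z))"
    by (simp add: dist_ray_time_le ray_time(1))
  also have "\<dots> = dist z (b (ray_time b z))"
    using assms by (simp add: dist_commute)
  finally show ?thesis
    using ray_time_unique[of "ray_time b v" z] ray_time(1)[of v] by simp
qed

text \<open>A crude modulus of continuity: \<open>z\<close> is nearly as close to the projection of
  \<open>y\<close> as to its own. It gives continuity and the boundedness of projected
  balls.\<close>

lemma ray_time_diff:
  "(ray_time b y - ray_time b z)\<^sup>2 \<le> 16 * dist z y * (dist z y + dist z (b (ray_time b z)))"
proof -
  define d D where "d = dist z y" "D = dist z (b (ray_time b z))"
  have "dist z (b (ray_time b y)) \<le> dist z y + dist y (b (ray_time b y))"
    by (rule dist_triangle)
  also have "\<dots> \<le> dist z y + dist y (b (ray_time b z))"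
    by (simp add: dist_ray_time_le ray_time(1))
  also have "\<dots> \<le> dist z y + (dist y z + dist z (b (ray_time b z)))"
    by (intro add_left_mono dist_triangle)
  finally have "dist z (b (ray_time b y)) \<le> 2 * d + D"
    by (simp add: dist_commute d_D_def)
  then have "(dist z (b (ray_time b y)))\<^sup>2 \<le> (2 * d + D)\<^sup>2"
    by (intro power_mono) auto
  then have "D\<^sup>2 + (ray_time b y - ray_time b z)\<^sup>2 / 4 \<le> (2 * d + D)\<^sup>2"
    using ray_time_pythagoras[OF ray_time(1)[of y], of z] unfolding d_D_def by linarith
  then show ?thesis
    unfolding d_D_def[symmetric] by (simp add: power2_eq_square algebra_simps)
qed

lemma isCont_ray_time: "isCont (ray_time b) z"
proof -
  have "((\<lambda>y. 16 * dist z y * (dist z y + dist z (b (ray_time b z)))) \<longlongrightarrow>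
      16 * dist z z * (dist z z + dist z (b (ray_time b z)))) (at z)"
    by (intro tendsto_intros)
  then have "((\<lambda>y. 16 * dist z y * (dist z y + dist z (b (ray_time b z)))) \<longlongrightarrow> 0) (at z)"
    by simp
  then have "((\<lambda>y. (ray_time b y - ray_time b z)\<^sup>2) \<longlongrightarrow> 0) (at z)"
    by (rule Lim_null_comparison[rotated]) (auto simp: ray_time_diff)
  then have "((\<lambda>y. sqrt ((ray_time b y - ray_time b z)\<^sup>2)) \<longlongrightarrow> sqrt 0) (at z)"
    by (rule tendsto_real_sqrt)
  then have "((\<lambda>y. ray_time b y - ray_time b z) \<longlongrightarrow> 0) (at z)"
    by (simp add: tendsto_rabs_zero_iff)
  then show ?thesis
    unfolding isCont_def by (rule LIM_zero_cancel)
qed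

lemma ray_time_contraction:
  assumes n: "\<forall>x r. ball x r \<inter> b ` {0..} = {} \<longrightarrow>
      diameter (nearest_point (b ` {0..}) ` ball x r) \<le> n * \<kappa> (dist x (b 0))"
    and xy: "dist x y < dist x (b (ray_time b x))"
  shows "\<bar>ray_time b x - ray_time b y\<bar> \<le> n * \<kappa> (dist x (b 0))"
proof -
  let ?r = "dist x (b (ray_time b x))" and ?\<pi> = "nearest_point (b ` {0..})"
  \<comment> \<open>The supremum in \<open>diameter\<close> controls distances only for bounded
    sets.\<close>
  have "bounded (?\<pi> ` ball x ?r)"
  proof -
    have "dist (?\<pi> x) (?\<pi> z) \<le> sqrt (32 * ?r\<^sup>2)" if "z \<in> ball x ?r" for z
    proof (rule real_le_rsqrt)
      have "(dist (?\<pi> x) (?\<pi> z))\<^sup>2 = (ray_time b z - ray_time b x)\<^sup>2"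
        by (simp add: ray_time(2)[symmetric] dist_ray ray_time(1) power2_commute)
      also have "\<dots> \<le> 16 * dist x z * (dist x z + ?r)"
        by (rule ray_time_diff)
      also have "\<dots> \<le> 16 * ?r * (?r + ?r)"
        using that by (intro mult_mono) auto
      finally show "(dist (?\<pi> x) (?\<pi> z))\<^sup>2 \<le> 32 * ?r\<^sup>2"
        by (simp add: power2_eq_square)
    qed
    then show ?thesis
      unfolding bounded_def by (intro exI[of _ "?\<pi> x"] exI[of _ "sqrt (32 * ?r\<^sup>2)"]) blast
  qed
  then have "dist (?\<pi> x) (?\<pi> y) \<le> diameter (?\<pi> ` ball x ?r)"
    using xy by (intro diameter_bounded_bound imageI)
      (auto simp del: zero_less_dist_iff intro: le_less_trans[OF zero_le_dist])
  moreover have "ball x ?r \<inter> b ` {0..} = {}"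
    using dist_ray_time_le[of _ x] by (force simp: not_less)
  ultimately have "dist (?\<pi> x) (?\<pi> y) \<le> n * \<kappa> (dist x (b 0))"
    using n by (meson order_trans)
  then show ?thesis
    by (simp add: ray_time(2)[symmetric] dist_ray ray_time(1))
qed

end

section \<open>Tree-like geodesics\<close>

text \<open>
  Up to \<open>e\<close>, every point sees the geodesic \<open>c\<close> on \<open>[0, L]\<close> as it would see a segment in a tree:
  each geodesic to \<open>c\<close> enters it at the point \<open>c u\<close>.
\<close>

definition tree_like :: "(real \<Rightarrow> 'a::metric_space) \<Rightarrow> real \<Rightarrow> real \<Rightarrow> bool" where
  "tree_like c L e \<longleftrightarrow>
     (\<forall>z. \<exists>u\<in>{0..L}. \<forall>v\<in>{0..L}. dist z (c u) + \<bar>v - u\<bar> - e \<le> dist z (c v))"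

lemma tree_like_mono:
  assumes "tree_like c L e" "e \<le> e'"
  shows "tree_like c L e'"
  unfolding tree_like_def
proof
  fix z
  obtain u where u: "u \<in> {0..L}" "\<forall>v\<in>{0..L}. dist z (c u) + \<bar>v - u\<bar> - e \<le> dist z (c v)"
    using assms(1) unfolding tree_like_def by blast
  then have "\<forall>v\<in>{0..L}. dist z (c u) + \<bar>v - u\<bar> - e' \<le> dist z (c v)"
    using assms(2) by force
  then show "\<exists>u\<in>{0..L}. \<forall>v\<in>{0..L}. dist z (c u) + \<bar>v - u\<bar> - e' \<le> dist z (c v)"
    using u(1) by blast
qed

lemma geodesic_path_continuous: "isometric_on S c \<Longrightarrow> continuous_on S c"
  unfolding continuous_on_iff isometric_on_def by metis

section \<open>Sublinear contraction makes long initial pieces tree-like\<close>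

context
  fixes b :: "real \<Rightarrow> 'a::{cat0_space, proper_metric_space}" and \<kappa> :: "real \<Rightarrow> real"
    and n :: real
  assumes ray: "geodesic_ray b" and n: "0 \<le> n" and \<kappa>: "sublinear \<kappa>"
    and contr: "\<forall>x r. ball x r \<inter> b ` {0..} = {} \<longrightarrow>
      diameter (nearest_point (b ` {0..}) ` ball x r) \<le> n * \<kappa> (dist x (b 0))"
begin

lemma ray_time_contraction_bounded:
  assumes "dist x y < dist x (b (ray_time b x))" "dist x (b 0) \<le> R"
  shows "\<bar>ray_time b x - ray_time b y\<bar> \<le> n * \<kappa> R"
proof -
  have "0 \<le> R" using assms(2) zero_le_dist order_trans by blast
  then have "\<kappa> (dist x (b 0)) \<le> \<kappa> R"
    using \<kappa> assms(2) by (auto simp: sublinear_def mono_on_def)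
  then show ?thesis
    using ray_time_contraction[OF ray contr assms(1)] n by (meson mult_left_mono order_trans)
qed

text \<open>
  Follow the geodesic from \<open>v\<close> to the ray in \<open>N\<close> steps shorter than \<open>\<theta>\<close>: as long as it stays
  \<open>\<theta>\<close>-far from the ray, each step moves the projection by at most \<open>n * \<kappa> R\<close>.
\<close>

lemma ray_entrance_near:
  assumes u: "0 \<le> u" and v: "dist v (b u) < real N * \<theta>" and "0 < N" "0 < \<theta>"
    and R: "dist v (b 0) + dist v (b u) \<le> R"
  shows "dist v (b (ray_time b v)) + \<bar>u - ray_time b v\<bar> - 2 * (\<theta> + real N * (n * \<kappa> R))
    \<le> dist v (b u)"
proof -
  define D where "D = dist v (b u)"
  obtain c where c: "isometric_on {0..D} c" "c 0 = v" "c D = b u"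
    unfolding D_def by (rule geodesic_path_exists)
  define y where "y i = c (real i * (D / real N))" for i
  have D: "0 \<le> D" by (simp add: D_def)
  have in_D: "real i * (D / real N) \<in> {0..D}" if "i \<le> N" for i
  proof -
    have "real i * D \<le> real N * D" using that D by (intro mult_right_mono) auto
    then show ?thesis using D \<open>0 < N\<close> by (auto simp: field_simps)
  qed
  have dy: "dist (y i) (y j) = \<bar>real i - real j\<bar> * (D / real N)" if "i \<le> N" "j \<le> N" for i j
  proof -
    have "dist (y i) (y j) = \<bar>real i * (D / real N) - real j * (D / real N)\<bar>"
      using c(1) in_D that by (simp add: isometric_on_def y_def dist_real_def)
    also have "\<dots> = \<bar>real i - real j\<bar> * (D / real N)"
      using D by (simp only: left_diff_distrib[symmetric] abs_mult) simp
    finally show ?thesis .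
  qed
  have y0: "y 0 = v" and yN: "y N = b u"
    using c \<open>0 < N\<close> by (auto simp: y_def)
  have step: "D / real N < \<theta>"
    using v \<open>0 < N\<close> by (simp add: D_def field_simps)
  define far where "far i = dist (y i) (b (ray_time b (y i)))" for i
  define k where "k = (LEAST i. far i < \<theta>)"
  have "far N < \<theta>"
    using ray_time_self[OF ray u] \<open>0 < \<theta>\<close> by (simp add: far_def yN)
  then have k: "far k < \<theta>" "k \<le> N"
    unfolding k_def by (auto intro: LeastI Least_le)
  have move: "\<bar>ray_time b (y i) - ray_time b (y 0)\<bar> \<le> real i * (n * \<kappa> R)" if "i \<le> k" for i
    using that
  proof (induction i)
    case (Suc i)
    then have "\<theta> \<le> far i"
      using not_less_Least[of i "\<lambda>i. far i < \<theta>"] by (simp add: k_def)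
    moreover have "dist (y i) (y (Suc i)) < \<theta>"
      using dy[of i "Suc i"] Suc.prems k step by simp
    moreover have "dist (y i) (b 0) \<le> R"
    proof -
      have "dist (y i) (y 0) \<le> D"
        using dy[of i 0] in_D[of i] Suc.prems k by simp
      then show ?thesis
        using R dist_triangle[of "y i" "b 0" v] by (simp add: D_def y0)
    qed
    ultimately have "\<bar>ray_time b (y i) - ray_time b (y (Suc i))\<bar> \<le> n * \<kappa> R"
      by (intro ray_time_contraction_bounded) (auto simp: far_def)
    moreover have "\<bar>ray_time b (y i) - ray_time b (y 0)\<bar> \<le> real i * (n * \<kappa> R)"
      using Suc by simp
    ultimately show ?case
      by (simp add: algebra_simps)
  qed simp
  have "0 \<le> R" using R zero_le_dist[of v "b 0"] zero_le_dist[of v "b u"] by linarith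
  then have "0 \<le> n * \<kappa> R"
    using \<kappa> n by (intro mult_nonneg_nonneg) (auto simp: sublinear_def intro: order_trans[of 0 1])
  then have "real k * (n * \<kappa> R) \<le> real N * (n * \<kappa> R)"
    using k by (intro mult_right_mono) auto
  then have mv: "\<bar>ray_time b (y k) - ray_time b v\<bar> \<le> real N * (n * \<kappa> R)"
    using move[of k] y0 by simp
  let ?p = "b (ray_time b (y k))" and ?q = "b (ray_time b v)"
  have pq: "dist ?p ?q = \<bar>ray_time b (y k) - ray_time b v\<bar>"
    and pu: "dist ?p (b u) = \<bar>ray_time b (y k) - u\<bar>"
    using ray u by (simp_all add: dist_ray ray_time(1))
  have "dist v (b u) = dist v (y k) + dist (y k) (b u)"
  proof -
    define s where "s = D / real N"
    have "dist v (y k) = real k * s" "dist (y k) (b u) = (real N - real k) * s"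
      using dy[of 0 k] dy[of k N] k by (auto simp: y0 yN s_def)
    then have "dist v (y k) + dist (y k) (b u) = real N * s"
      by (simp add: left_diff_distrib)
    then show ?thesis using \<open>0 < N\<close> by (simp add: D_def s_def)
  qed
  moreover have "dist v ?q \<le> dist v (y k) + far k + dist ?p ?q"
    using dist_triangle[of v ?q "y k"] dist_triangle[of "y k" ?q ?p] by (simp add: far_def)
  moreover have "dist ?p (b u) \<le> far k + dist (y k) (b u)"
    using dist_triangle[of ?p "b u" "y k"] by (simp add: far_def dist_commute)
  moreover have "\<bar>u - ray_time b v\<bar> \<le> dist ?p ?q + dist ?p (b u)"
    unfolding pq pu by linarith
  ultimately show ?thesis
    using mv k(1) unfolding pq by (simp add: algebra_simps)
qed

text \<open>Cut the geodesic from \<open>b t\<close> to \<open>z\<close> at distance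
  \<open>L\<close>. The cut point \<open>v\<close> still projects to \<open>b t\<close> and is near
  enough for the stepwise estimate; \<open>almost_geodesic_extend\<close> carries the result out to
  \<open>z\<close> at four times the error.\<close>

lemma ray_tree_like_aux:
  assumes L: "0 < L" and \<epsilon>: "0 < \<epsilon>" "\<epsilon> \<le> 1" and N: "2 < real N * \<epsilon>"
    and small: "real N * (n * \<kappa> (4 * L)) \<le> \<epsilon> * L"
    and u: "u \<in> {0..L}" and z: "ray_time b z \<le> L"
  shows "dist z (b (ray_time b z)) + \<bar>u - ray_time b z\<bar> - 16 * \<epsilon> * L \<le> dist z (b u)"
proof -
  define t A where "t = ray_time b z" and "A = dist (b t) z"
  have t: "0 \<le> t" "t \<le> L" using z ray_time(1)[OF ray] by (auto simp: t_def)
  define r where "r = min L A"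
  obtain v where v: "dist (b t) v = r" "dist v z = A - r"
    using between_exists[of r "b t" z] L by (auto simp: r_def A_def)
  have tv: "ray_time b v = t"
    unfolding t_def by (rule ray_time_between[OF ray]) (use v in \<open>simp add: t_def A_def\<close>)
  have bt: "dist (b t) (b u) = \<bar>u - t\<bar>" "dist (b t) (b 0) = t"
    using t u by (auto simp: dist_ray[OF ray])
  have r: "r \<le> L" by (simp add: r_def)
  \<comment> \<open>These bounds show that \<open>N\<close> steps shorter than
    \<open>\<epsilon> * L\<close> suffice and that the path stays within \<open>4 * L\<close> of
    \<open>b 0\<close>.\<close>
  have vu: "dist v (b u) \<le> 2 * L" "dist v (b 0) \<le> 2 * L"
    using dist_triangle[of v "b u" "b t"] dist_triangle[of v "b 0" "b t"] v r t u bt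
    by (auto simp: dist_commute)
  have "2 * L < real N * \<epsilon> * L" using N L by simp
  then have "dist v (b u) < real N * (\<epsilon> * L)" using vu by (simp add: mult.assoc)
  moreover have "0 < N" using N by (cases N) auto
  ultimately have "dist v (b t) + \<bar>u - t\<bar> - 2 * (\<epsilon> * L + real N * (n * \<kappa> (4 * L))) \<le> dist v (b u)"
    using ray_entrance_near[of u v N "\<epsilon> * L" "4 * L"] u vu L \<epsilon> unfolding tv by auto
  then have loc: "r + \<bar>u - t\<bar> - 4 * (\<epsilon> * L) \<le> dist v (b u)"
    using small v(1) by (simp add: dist_commute distrib_left)
  have eL: "0 \<le> \<epsilon> * L" using L \<epsilon> by simp
  show ?thesis
  proof (cases "A \<le> L")
    case True
    then have "v = z" using v by (simp add: r_def)
    then show ?thesis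
      using loc True eL by (simp add: A_def r_def t_def[symmetric] dist_commute)
  next
    case False
    then have "r = L" by (simp add: r_def)
    show ?thesis
    proof (cases "4 * \<epsilon> \<le> 1")
      case True
      have "dist (b u) (b t) + dist (b t) z - 8 * (\<epsilon> * L) * (1 + dist (b u) (b t) / L) \<le>
          dist (b u) z"
        using v \<open>r = L\<close> L eL True loc bt
        using almost_geodesic_extend[of "b t" v L z "4 * (\<epsilon> * L)" "b u"]
        by (auto simp: A_def dist_commute)
      moreover have "dist (b u) (b t) / L \<le> 1"
        using bt t u L by (auto simp: dist_commute)
      then have "8 * (\<epsilon> * L) * (1 + dist (b u) (b t) / L) \<le> 16 * (\<epsilon> * L)"
        using eL mult_left_mono[of "1 + dist (b u) (b t) / L" 2 "8 * (\<epsilon> * L)"] by simp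
      ultimately have "dist (b u) (b t) + dist (b t) z - 16 * (\<epsilon> * L) \<le> dist (b u) z"
        by linarith
      then show ?thesis
        using bt unfolding t_def[symmetric] by (simp add: dist_commute mult.assoc)
    next
      \<comment> \<open>The allowed error is now at least \<open>4 * L\<close>, more than the detour
        through \<open>b t\<close> can cost.\<close>
      case False
      then have "4 * L \<le> 16 * \<epsilon> * L" using L by simp
      moreover have "\<bar>u - t\<bar> \<le> L" using t u by auto
      moreover have "dist z (b t) \<le> dist z (b u) + dist (b u) (b t)" by (rule dist_triangle)
      moreover have "dist (b u) (b t) = \<bar>u - t\<bar>" using bt by (simp add: dist_commute)
      ultimately show ?thesis using L unfolding t_def[symmetric] by linarith
    qed
  qed
qed

lemma ray_tree_like_at_scale:
  assumes L: "0 < L" and \<epsilon>: "0 < \<epsilon>" "\<epsilon> \<le> 1" and N: "2 < real N * \<epsilon>"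
    and small: "real N * (n * \<kappa> (4 * L)) \<le> \<epsilon> * L"
  shows "tree_like b L (16 * \<epsilon> * L)"
  unfolding tree_like_def
proof
  fix z
  show "\<exists>u\<in>{0..L}. \<forall>v\<in>{0..L}. dist z (b u) + \<bar>v - u\<bar> - 16 * \<epsilon> * L \<le> dist z (b v)"
  proof (cases "ray_time b z \<le> L")
    case True
    then show ?thesis
      using ray_tree_like_aux[OF assms] ray_time(1)[OF ray, of z]
      by (intro bexI[of _ "ray_time b z"]) auto
  next
    case False
    \<comment> \<open>Projections vary continuously along the geodesic from \<open>b v\<close> to
      \<open>z\<close>, so one of its points projects to \<open>b L\<close>. The estimate for that
      point passes on to \<open>z\<close>.\<close>
    have "dist z (b L) + \<bar>v - L\<bar> - 16 * \<epsilon> * L \<le> dist z (b v)" if v: "v \<in> {0..L}" for v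
    proof -
      obtain c where c: "isometric_on {0..dist (b v) z} c" "c 0 = b v" "c (dist (b v) z) = z"
        by (rule geodesic_path_exists)
      have "continuous_on {0..dist (b v) z} (\<lambda>x. ray_time b (c x))"
        by (intro continuous_on_compose2[OF continuous_at_imp_continuous_on[of UNIV]
              geodesic_path_continuous[OF c(1)]] ballI isCont_ray_time[OF ray]) auto
      then obtain x where x: "x \<in> {0..dist (b v) z}" "ray_time b (c x) = L"
        using IVT'[of "\<lambda>x. ray_time b (c x)" 0 L "dist (b v) z"] False v
        by (auto simp: c ray_time_self[OF ray])
      have "dist (b v) (c x) + dist (c x) z = dist (b v) z"
      proof -
        have "dist (c 0) (c x) = x" "dist (c x) (c (dist (b v) z)) = dist (b v) z - x"
          using c(1) x(1) by (auto simp: isometric_on_def dist_real_def)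
        then show ?thesis by (simp add: c)
      qed
      moreover have "dist (c x) (b L) + \<bar>v - L\<bar> - 16 * \<epsilon> * L \<le> dist (c x) (b v)"
        using ray_tree_like_aux[OF assms v, of "c x"] x by simp
      moreover have "dist z (b L) \<le> dist z (c x) + dist (c x) (b L)"
        by (rule dist_triangle)
      ultimately show ?thesis
        by (simp add: dist_commute)
    qed
    then show ?thesis
      using L by (intro bexI[of _ L]) auto
  qed
qed

lemma ray_tree_like:
  assumes "0 < \<epsilon>"
  shows "\<exists>L\<ge>M. 0 < L \<and> tree_like b L (\<epsilon> * L)"
proof -
  define \<delta> where "\<delta> = min 1 (\<epsilon> / 16)"
  have \<delta>: "0 < \<delta>" "\<delta> \<le> 1" "16 * \<delta> \<le> \<epsilon>" using assms by (auto simp: \<delta>_def)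
  obtain N :: nat where "2 / \<delta> < real N" using reals_Archimedean2 by blast
  then have N: "2 < real N * \<delta>" using \<delta> by (simp add: field_simps)
  \<comment> \<open>\<open>N\<close> depends on \<open>\<delta>\<close> only, so the drift
    \<open>real N * (n * \<kappa> (4 * L))\<close> is sublinear in \<open>L\<close>. Taking
    \<open>n + 1\<close> keeps \<open>q\<close> positive when \<open>n = 0\<close>.\<close>
  define q where "q = 4 * (real N * (n + 1))"
  have q: "0 < q" using N n by (auto simp: q_def intro!: mult_pos_pos Nat.gr0I)
  have "((\<lambda>t. \<kappa> t / t) \<longlongrightarrow> 0) at_top"
    using \<kappa> by (simp add: sublinear_def)
  then have "\<forall>\<^sub>F t in at_top. \<kappa> t / t < \<delta> / q"
    using \<delta> q by (intro order_tendstoD) auto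
  then have "\<forall>\<^sub>F t in at_top. \<kappa> t / t < \<delta> / q \<and> max 4 (4 * M) \<le> t"
    using eventually_ge_at_top by (rule eventually_conj)
  then obtain t where t: "\<kappa> t / t < \<delta> / q" "4 \<le> t" "4 * M \<le> t"
    by (auto dest: eventually_happens)
  define L where "L = t / 4"
  have "\<kappa> t * q < \<delta> * t"
    using t q by (simp add: field_simps)
  moreover have "1 \<le> \<kappa> t" using \<kappa> t by (simp add: sublinear_def)
  then have "real N * (n * \<kappa> t) \<le> real N * ((n + 1) * \<kappa> t)"
    by (intro mult_left_mono mult_right_mono) auto
  ultimately have "real N * (n * \<kappa> (4 * L)) \<le> \<delta> * L"
    by (simp add: q_def L_def algebra_simps)
  then have "tree_like b L (16 * \<delta> * L)"
    using t \<delta> N by (intro ray_tree_like_at_scale) (auto simp: L_def)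
  moreover have "16 * \<delta> * L \<le> \<epsilon> * L"
    using \<delta> t by (intro mult_right_mono) (auto simp: L_def)
  ultimately have "tree_like b L (\<epsilon> * L)"
    by (rule tree_like_mono)
  then show ?thesis
    using t by (intro exI[of _ L]) (auto simp: L_def)
qed

end

text \<open>
  If \<open>z\<close> and \<open>z'\<close> lie on different sides of a piece of length \<open>2 * r\<close> of a tree-like geodesic,
  then \<open>[z, z']\<close> passes near its midpoint, however far \<open>z\<close> and \<open>z'\<close> are. A point \<open>w\<close> of
  \<open>[z, z']\<close> equidistant from the ends of the piece makes both \<open>[z, p] \<union> [p, w]\<close> and
  \<open>[w, p] \<union> [p, z']\<close> nearly geodesic, which is only possible for \<open>w\<close> near \<open>p\<close>.
\<close>

context
  fixes c :: "real \<Rightarrow> 'a::cat0_space" and L e :: real and entry :: "'a \<Rightarrow> real"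
  assumes c: "isometric_on {0..L} c"
    and entry: "\<And>z. entry z \<in> {0..L}"
      "\<And>z v. v \<in> {0..L} \<Longrightarrow> dist z (c (entry z)) + \<bar>v - entry z\<bar> - e \<le> dist z (c v)"
begin

lemma dist_c: "s \<in> {0..L} \<Longrightarrow> t \<in> {0..L} \<Longrightarrow> dist (c s) (c t) = \<bar>s - t\<bar>"
  using c by (auto simp: isometric_on_def dist_real_def)

lemma entry_upper: "v \<in> {0..L} \<Longrightarrow> dist z (c v) \<le> dist z (c (entry z)) + \<bar>v - entry z\<bar>"
  using dist_triangle[of z "c v" "c (entry z)"] dist_c[OF entry(1)[of z], of v] by simp

lemma dist_after_entry:
  assumes "s \<in> {0..L}" "t \<in> {0..L}" "entry z \<le> s" "s \<le> t"
  shows "dist z (c s) + (t - s) - e \<le> dist z (c t)"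
  using entry(2)[of t z] entry_upper[of s z] assms by simp

lemma dist_before_entry:
  assumes "s \<in> {0..L}" "t \<in> {0..L}" "t \<le> entry z" "s \<le> t"
  shows "dist z (c t) + (t - s) - e \<le> dist z (c s)"
  using entry(2)[of s z] entry_upper[of t z] assms by simp

lemma error_nonneg: "0 \<le> e"
  using entry(2)[OF entry(1), of undefined undefined] by simp

lemma entry_self:
  assumes "v \<in> {0..L}"
  shows "\<bar>entry (c v) - v\<bar> \<le> e / 2"
proof -
  have "dist (c v) (c (entry (c v))) = \<bar>v - entry (c v)\<bar>"
    using assms entry(1) by (rule dist_c)
  then show ?thesis
    using entry(2)[OF assms, of "c v"] abs_minus_commute[of "entry (c v)" v] by simp
qed

text \<open>Here \<open>q\<close> lies only nearly between \<open>p\<close> and \<open>z\<close>, so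
  it is replaced by the exact point \<open>x\<close> at distance \<open>r - e\<close> from
  \<open>p\<close>, which is \<open>\<eta>\<close>-close to \<open>q\<close>. The bound on
  \<open>4 * \<eta>\<close> keeps the loss proportional to \<open>dist w p\<close> at one
  half.\<close>

lemma near_extend:
  fixes p q w z :: 'a
  assumes r: "e < r" "8 * e * r \<le> \<eta>\<^sup>2" "0 \<le> \<eta>" "4 * \<eta> \<le> r - e"
    and q: "dist p q = r" "dist z q + r - e \<le> dist z p"
    and w: "dist w p + r - e \<le> dist w q"
  shows "dist w p + dist p z - 2 * \<eta> - dist w p / 2 \<le> dist w z"
proof -
  define A where "A = dist p z"
  have "r - e \<le> A"
    using q by (simp add: A_def dist_commute) (smt (verit) zero_le_dist)
  then obtain x where x: "dist p x = r - e" "dist x z = A - (r - e)"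
    using between_exists[of "r - e" p z] r unfolding A_def by (metis diff_ge_0_iff_ge less_imp_le)
  have "(dist q x)\<^sup>2 \<le> 8 * e * r"
    by (rule almost_between_close[of _ z "A - r + e" _ p])
       (use q x r error_nonneg in \<open>auto simp: A_def dist_commute\<close>)
  then have "(dist q x)\<^sup>2 \<le> \<eta>\<^sup>2" using r by linarith
  then have "dist q x \<le> \<eta>" using r(3) by (rule power2_le_imp_le)
  then have "dist w p + (r - e) - \<eta> \<le> dist w x"
    using w dist_triangle[of w q x] by (simp add: dist_commute)
  then have "dist w p + dist p z - 2 * \<eta> * (1 + dist w p / (r - e)) \<le> dist w z"
    by (intro almost_geodesic_extend[of p x]) (use x r in \<open>auto simp: A_def\<close>)
  moreover have "2 * \<eta> * (dist w p / (r - e)) \<le> dist w p / 2"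
  proof -
    have "dist w p * (4 * \<eta>) \<le> dist w p * (r - e)"
      using r by (intro mult_left_mono) auto
    then show ?thesis using r by (simp add: field_simps)
  qed
  ultimately show ?thesis by (simp add: distrib_left)
qed

lemma geodesic_passes_near:
  assumes r: "e < r" "8 * e * r \<le> \<eta>\<^sup>2" "0 \<le> \<eta>" "4 * \<eta> \<le> r - e"
    and m: "0 \<le> m - r" "m + r \<le> L"
    and z: "entry z \<le> m - r" "m + r \<le> entry z'"
    and g: "isometric_on {0..dist z z'} g" "g 0 = z" "g (dist z z') = z'"
  shows "\<exists>x\<in>{0..dist z z'}. dist (g x) (c m) \<le> 4 * \<eta>"
proof -
  let ?s = "m - r" and ?t = "m + r" and ?p = "c m"
  have in_L: "?s \<in> {0..L}" "?t \<in> {0..L}" "m \<in> {0..L}" and r0: "0 < r"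
    using r m error_nonneg by auto
  have dpq: "dist ?p (c ?s) = r" "dist ?p (c ?t) = r"
    using in_L r0 by (auto simp: dist_c)
  define F where "F x = dist (g x) (c ?s) - dist (g x) (c ?t)" for x
  have "continuous_on {0..dist z z'} F"
    unfolding F_def by (intro continuous_intros geodesic_path_continuous g)
  moreover have "F 0 \<le> 0"
    using dist_after_entry[of ?s ?t z] in_L z r r0 by (simp add: F_def g)
  moreover have "0 \<le> F (dist z z')"
    using dist_before_entry[of ?s ?t z'] in_L z r r0 by (simp add: F_def g)
  ultimately obtain x where x: "x \<in> {0..dist z z'}" "F x = 0"
    using IVT'[of F 0 0 "dist z z'"] by auto
  define w where "w = g x"
  have eq: "dist w (c ?s) = dist w (c ?t)"
    using x by (simp add: F_def w_def)
  \<comment> \<open>Whichever side of \<open>m\<close> the entry of \<open>w\<close> falls on, one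
    end of the piece lies behind \<open>?p\<close> as seen from \<open>w\<close>; by equidistance
    the bound holds for both ends.\<close>
  have w: "dist w ?p + r - e \<le> dist w (c ?s)"
  proof (cases "m \<le> entry w")
    case True
    then show ?thesis
      using dist_before_entry[of ?s m w] in_L r0 by simp
  next
    case False
    then show ?thesis
      using dist_after_entry[of m ?t w] in_L r0 eq by simp
  qed
  have "dist w ?p + dist ?p z - 2 * \<eta> - dist w ?p / 2 \<le> dist w z"
    by (rule near_extend[OF r, of _ "c ?s"])
       (use dpq w dist_after_entry[of ?s m z] in_L z r0 in auto)
  moreover have "dist w ?p + dist ?p z' - 2 * \<eta> - dist w ?p / 2 \<le> dist w z'"
    by (rule near_extend[OF r, of _ "c ?t"])
       (use dpq w eq dist_before_entry[of m ?t z'] in_L z r0 in auto)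
  moreover have "dist w z + dist w z' = dist z z'"
  proof -
    have "dist (g x) (g 0) = x" "dist (g x) (g (dist z z')) = dist z z' - x"
      using g(1) x(1) by (auto simp: isometric_on_def dist_real_def)
    then show ?thesis by (simp add: g w_def)
  qed
  ultimately have "dist w ?p \<le> 4 * \<eta>"
    using dist_triangle[of z z' ?p] by (simp add: dist_commute)
  then show ?thesis using x w_def by blast
qed

lemma almost_through:
  assumes r: "e < r" "8 * e * r \<le> \<eta>\<^sup>2" "0 \<le> \<eta>" "4 * \<eta> \<le> r - e"
    and m: "0 \<le> m - r" "m + r \<le> L"
    and z: "entry z \<le> m - r" "m + r \<le> entry z'"
  shows "dist z (c m) + dist (c m) z' - 8 * \<eta> \<le> dist z z'"
proof -
  obtain g where g: "isometric_on {0..dist z z'} g" "g 0 = z" "g (dist z z') = z'"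
    by (rule geodesic_path_exists)
  then obtain x where x: "x \<in> {0..dist z z'}" "dist (g x) (c m) \<le> 4 * \<eta>"
    using geodesic_passes_near[OF r m z] by blast
  have "dist (g 0) (g x) = x" "dist (g x) (g (dist z z')) = dist z z' - x"
    using g(1) x(1) by (auto simp: isometric_on_def dist_real_def)
  then show ?thesis
    using x(2) dist_triangle[of z "c m" "g x"] dist_triangle[of "c m" z' "g x"]
    by (simp add: g dist_commute)
qed

text \<open>
  An isometry which moves \<open>c s\<close> to \<open>c t\<close> either folds \<open>c\<close> back along itself there, or maps one
  half-space deeply into another.
\<close>

lemma fold_or_nest:
  assumes h: "\<And>x y. dist (h x) (h y) = dist x y" and st: "dist (h (c s)) (c t) \<le> e1"
    and r: "0 \<le> r" "0 \<le> s" "s + r \<le> L" "0 \<le> t - r" "t \<le> L"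
    and y: "s + r \<le> entry y" "entry (h y) < t - r"
  shows "(dist (c (t - r)) (h (c (s + r))))\<^sup>2 \<le> 8 * (e + 2 * e1) * (r + e1)"
\<comment> \<open>Both \<open>c (t - r)\<close> and \<open>h (c (s + r))\<close> are nearly between
  \<open>h y\<close> and \<open>c t\<close>, at distance about \<open>r\<close> from
  \<open>c t\<close>.\<close>
proof (rule almost_between_close)
  let ?p = "c t" and ?y = "h y"
  have in_L: "s \<in> {0..L}" "s + r \<in> {0..L}" "t \<in> {0..L}" "t - r \<in> {0..L}"
    using r by auto
  have e1: "0 \<le> e1" using st zero_le_dist order_trans by blast
  have "dist ?y (c (t - r)) + r - e \<le> dist ?y ?p"
    using dist_after_entry[of "t - r" t ?y] in_L y r by simp
  then show "dist (c (t - r)) ?y \<le> dist ?y ?p - r + e + e1"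
    using e1 by (simp add: dist_commute)
  have "dist y (c (s + r)) + r - e \<le> dist y (c s)"
    using dist_before_entry[of s "s + r" y] in_L y r by simp
  then have "dist ?y (h (c (s + r))) + r - e \<le> dist ?y (h (c s))"
    by (simp add: h)
  also have "\<dots> \<le> dist ?y ?p + e1"
    using st dist_triangle[of ?y "h (c s)" ?p] by (simp add: dist_commute)
  finally show "dist (h (c (s + r))) ?y \<le> dist ?y ?p - r + e + e1"
    by (simp add: dist_commute)
  show "dist (c (t - r)) ?p \<le> r + e1"
    using in_L r e1 by (simp add: dist_c)
  have "dist (h (c (s + r))) (h (c s)) = r"
    using in_L r by (simp add: dist_c h)
  then show "dist (h (c (s + r))) ?p \<le> r + e1"
    using st dist_triangle[of "h (c (s + r))" ?p "h (c s)"] by simp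
  show "dist ?y ?p - r + e + e1 + (r + e1) \<le> dist ?y ?p + (e + 2 * e1)"
    by simp
qed

end

section \<open>Axes\<close>

text \<open>Abstracts the powers of one group element, which is itself \<open>T 1\<close>.\<close>

locale integer_action =
  fixes T :: "int \<Rightarrow> 'a::cat0_space \<Rightarrow> 'a"
  assumes T_0 [simp]: "T 0 x = x"
    and T_add: "T (i + j) x = T i (T j x)"
    and T_dist [simp]: "dist (T i x) (T i y) = dist x y"
begin

lemma dist_T_swap: "dist (T (- i) x) y = dist x (T i y)"
  by (metis T_0 T_add T_dist add.right_inverse)

lemma dist_T_le:
  "dist x (T (int n) x) \<le> real n * dist x (T 1 x)"
proof (induction n)
  case (Suc n)
  have "dist x (T (int (Suc n)) x) \<le> dist x (T (int n) x) + dist (T (int n) x) (T (int (Suc n)) x)"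
    by (rule dist_triangle)
  also have "dist (T (int n) x) (T (int (Suc n)) x) = dist x (T 1 x)"
    using T_add[of "int n" 1 x] by (simp add: add.commute)
  finally show ?case using Suc by (simp add: algebra_simps)
qed simp

context
  fixes x :: 'a and a :: real
  assumes min: "\<And>y. a \<le> dist y (T 1 y)" and attained: "dist x (T 1 x) = a" and pos: "0 < a"
begin

text \<open>
  For \<open>m\<close> the midpoint of \<open>y\<close> and \<open>T n y\<close>, the point \<open>T n m\<close> is the midpoint of \<open>T n y\<close> and
  \<open>T (2 * n) y\<close>, so that the minimal displacement at least doubles from \<open>T n\<close> to \<open>T (2 * n)\<close>.
\<close>

lemma displacement_power_of_2: "2 ^ k * a \<le> dist y (T (2 ^ k) y)"
proof (induction k arbitrary: y)
  case (Suc k)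
  let ?n = "2 ^ k :: int"
  obtain m where m: "dist y m = dist y (T ?n y) / 2" "dist m (T ?n y) = dist y (T ?n y) / 2"
    by (rule midpoint_exists)
  have "dist m (T ?n m) \<le> dist y (T ?n (T ?n y)) / 2"
    by (rule midpoint_line[OF m]) (use m in simp_all)
  moreover have "T ?n (T ?n y) = T (2 ^ Suc k) y"
    using T_add[of ?n ?n y] by simp
  ultimately show ?case
    using Suc[of m] by simp
qed (simp add: min)

text \<open>The upper bound is the triangle inequality. If it were strict at \<open>n\<close>, the
  upper bound for the remaining \<open>2 ^ n - n\<close> steps would contradict the lower bound at
  \<open>2 ^ n\<close>.\<close>

lemma orbit_geodesic_nat: "dist x (T (int n) x) = real n * a"
proof (rule antisym)
  show "dist x (T (int n) x) \<le> real n * a"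
    using dist_T_le[of x n] by (simp add: attained)
  have n: "n < 2 ^ n" by simp
  define k where "k = 2 ^ n - n"
  have k: "2 ^ n = int n + int k" "2 ^ n = real n + real k"
    using n by (simp_all add: k_def of_nat_diff)
  have "2 ^ n * a \<le> dist x (T (int n + int k) x)"
    using displacement_power_of_2[of n x] k by simp
  also have "\<dots> \<le> dist x (T (int n) x) + dist (T (int n) x) (T (int n + int k) x)"
    by (rule dist_triangle)
  also have "dist (T (int n) x) (T (int n + int k) x) \<le> real k * a"
    using dist_T_le[of x k] by (simp add: T_add attained)
  finally show "real n * a \<le> dist x (T (int n) x)"
    using k by (simp add: algebra_simps)
qed

lemma orbit_geodesic: "i \<le> j \<Longrightarrow> dist (T i x) (T j x) = (of_int j - of_int i) * a"
  using orbit_geodesic_nat[of "nat (j - i)"] T_add[of i "j - i" x] by simp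

text \<open>String together the translates of a geodesic from \<open>x\<close> to
  \<open>T 1 x\<close>; \<open>k t\<close> is the index of the translate containing
  \<open>l t\<close>. Orbit points are as far apart as this path is long, so it has no
  shortcuts.\<close>

lemma axis_through:
  "\<exists>l. geodesic_line l \<and> (\<forall>i t. T i (l t) = l (t + of_int i * a)) \<and> l 0 = x"
proof -
  obtain c where c: "isometric_on {0..a} c" "c 0 = x" "c a = T 1 x"
    using geodesic_path_exists[of x "T 1 x"] unfolding attained by metis
  define k where "k t = \<lfloor>t / a\<rfloor>" for t
  define l where "l t = T (k t) (c (t - of_int (k t) * a))" for t
  have k: "of_int (k t) * a \<le> t" "t < of_int (k t) * a + a" for t
    using floor_divide_lower[OF pos, of t] floor_divide_upper[OF pos, of t]
    by (auto simp: k_def algebra_simps)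
  have seg: "t - of_int (k t) * a \<in> {0..a}" for t
    using k[of t] by auto
  have equiv: "T i (l t) = l (t + of_int i * a)" for i t
  proof -
    have "k (t + of_int i * a) = i + k t"
      using pos by (simp add: k_def add_divide_distrib)
    then show ?thesis by (simp add: l_def T_add algebra_simps)
  qed
  have l0: "l 0 = x" by (simp add: l_def k_def c)
  have lk: "l (of_int i * a) = T i x" for i
    using equiv[of i 0] l0 by simp
  have down: "dist (T (k t) x) (l t) = t - of_int (k t) * a" for t
  proof -
    have "dist (T (k t) x) (l t) = dist (c 0) (c (t - of_int (k t) * a))"
      by (simp add: l_def c)
    also have "\<dots> = t - of_int (k t) * a"
      using c(1) seg[of t] pos by (simp add: isometric_on_def dist_real_def)
    finally show ?thesis .
  qed
  have up: "dist (l t) (T (k t + 1) x) = of_int (k t) * a + a - t" for t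
  proof -
    have "dist (l t) (T (k t + 1) x) = dist (c (t - of_int (k t) * a)) (c a)"
      by (simp add: l_def c T_add)
    also have "\<dots> = of_int (k t) * a + a - t"
      using c(1) seg[of t] pos by (simp add: isometric_on_def dist_real_def)
    finally show ?thesis .
  qed
  have le: "dist (l s) (l t) \<le> t - s" if "s \<le> t" for s t
  proof (cases "k s = k t")
    case True
    have "dist (l s) (l t) = dist (c (s - of_int (k t) * a)) (c (t - of_int (k t) * a))"
      by (simp add: l_def True)
    also have "\<dots> = t - s"
      using c(1) seg[of t] seg[of s] that True by (simp add: isometric_on_def dist_real_def)
    finally show ?thesis by simp
  next
    case False
    have "k s \<le> k t"
      using that pos by (simp add: k_def floor_mono divide_right_mono)
    then have "k s + 1 \<le> k t" using False by simp
    then have "dist (T (k s + 1) x) (T (k t) x) = (of_int (k t) - of_int (k s) - 1) * a"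
      by (simp add: orbit_geodesic)
    moreover have "dist (l s) (l t) \<le>
        dist (l s) (T (k s + 1) x) + (dist (T (k s + 1) x) (T (k t) x) + dist (T (k t) x) (l t))"
      using dist_triangle[of "l s" "l t" "T (k s + 1) x"]
        dist_triangle[of "T (k s + 1) x" "l t" "T (k t) x"] by simp
    ultimately show ?thesis
      unfolding up down by (simp add: algebra_simps)
  qed
  have ge: "t - s \<le> dist (l s) (l t)" if "s \<le> t" for s t
  proof -
    have "k s \<le> k t"
      using that pos by (simp add: k_def floor_mono divide_right_mono)
    then have "dist (T (k s) x) (T (k t + 1) x) = (of_int (k t) + 1 - of_int (k s)) * a"
      by (simp add: orbit_geodesic)
    moreover have "dist (T (k s) x) (T (k t + 1) x) \<le>
        dist (T (k s) x) (l s) + (dist (l s) (l t) + dist (l t) (T (k t + 1) x))"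
      using dist_triangle[of "T (k s) x" "T (k t + 1) x" "l s"]
        dist_triangle[of "l s" "T (k t + 1) x" "l t"] by simp
    ultimately show ?thesis
      unfolding up down by (simp add: algebra_simps)
  qed
  have "dist (l s) (l t) = dist s t" for s t
    using le[of s t] ge[of s t] le[of t s] ge[of t s]
    by (cases "s \<le> t") (auto simp: dist_real_def dist_commute)
  then have "geodesic_line l"
    by (simp add: geodesic_line_def isometric_on_def)
  then show ?thesis using equiv l0 by blast
qed

end

end

section \<open>Nested half-spaces give rank one\<close>

text \<open>The half-spaces are the sets of points which enter the geodesic after a given time.\<close>

locale nested_half_spaces = integer_action T for T :: "int \<Rightarrow> 'a::cat0_space \<Rightarrow> 'a" +
  fixes c :: "real \<Rightarrow> 'a" and L e :: real and entry :: "'a \<Rightarrow> real" and \<alpha> \<rho> :: real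
  assumes c: "isometric_on {0..L} c"
    and entry: "\<And>z. entry z \<in> {0..L}"
      "\<And>z v. v \<in> {0..L} \<Longrightarrow> dist z (c (entry z)) + \<bar>v - entry z\<bar> - e \<le> dist z (c v)"
    and \<rho>: "0 < \<rho>" "100000 * e \<le> \<rho>"
    and \<alpha>: "0 \<le> \<alpha>" "\<alpha> + 4 * \<rho> \<le> L"
    and nested: "\<And>z. \<alpha> \<le> entry z \<Longrightarrow> \<alpha> + 4 * \<rho> \<le> entry (T 1 z)"
begin

lemmas e_nonneg = error_nonneg[OF c entry]

text \<open>These are the hypotheses of \<open>geodesic_passes_near\<close> for
  \<open>r = \<rho>\<close> and \<open>\<eta> = \<rho> / 100\<close>.\<close>

lemma constants:
  "e < \<rho>" "8 * e * \<rho> \<le> (\<rho> / 100)\<^sup>2" "0 \<le> \<rho> / 100" "4 * (\<rho> / 100) \<le> \<rho> - e"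
proof -
  have "8 * e * \<rho> \<le> \<rho> / 10000 * \<rho>"
    using \<rho> by (intro mult_right_mono) auto
  then show "8 * e * \<rho> \<le> (\<rho> / 100)\<^sup>2" by (simp add: power2_eq_square)
qed (use \<rho> e_nonneg in auto)

lemma nested_back: "entry z < \<alpha> + 4 * \<rho> \<Longrightarrow> entry (T (- 1) z) < \<alpha>"
  using nested[of "T (- 1) z"] T_add[of 1 "- 1" z] by force

lemma crossing:
  assumes "entry z < \<alpha>" "\<alpha> + 4 * \<rho> \<le> entry z'" "i \<in> {1, 2, 3}"
    and g: "isometric_on {0..dist z z'} g" "g 0 = z" "g (dist z z') = z'"
  shows "\<exists>x\<in>{0..dist z z'}. dist (g x) (c (\<alpha> + i * \<rho>)) \<le> \<rho> / 25"
  using geodesic_passes_near[OF c entry constants, of "\<alpha> + i * \<rho>" z z' g] assms \<alpha> \<rho> by auto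

text \<open>The middle of the piece between the two nested half-spaces, from which orbits are
  measured.\<close>

definition p where "p = c (\<alpha> + 2 * \<rho>)"

lemma crossing_p:
  assumes "entry z < \<alpha>" "\<alpha> + 4 * \<rho> \<le> entry z'"
  shows "dist z p + dist p z' - \<rho> / 10 \<le> dist z z'"
  using almost_through[OF c entry constants, of "\<alpha> + 2 * \<rho>" z z'] assms \<alpha> \<rho>
  by (auto simp: p_def)

lemma entry_p: "\<alpha> \<le> entry p" "entry p < \<alpha> + 4 * \<rho>"
proof -
  have "\<bar>entry p - (\<alpha> + 2 * \<rho>)\<bar> \<le> e / 2"
    unfolding p_def by (rule entry_self[OF c entry]) (use \<alpha> \<rho> in auto)
  then show "\<alpha> \<le> entry p" "entry p < \<alpha> + 4 * \<rho>"
    using constants(1) \<rho>(1) unfolding abs_le_iff by linarith+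
qed

lemma entry_p_forward: "\<alpha> + 4 * \<rho> \<le> entry (T (int n + 1) p)"
proof (induction n)
  case (Suc n)
  then show ?case
    using nested[of "T (int n + 1) p"] T_add[of 1 "int n + 1" p] \<rho> by (simp add: add.commute)
qed (use nested entry_p in simp)

lemma entry_p_back: "entry (T (- 1) p) < \<alpha>"
  using nested_back entry_p by blast

lemma dist_p: "\<rho> \<le> dist p (T 1 p)"
proof -
  have "dist (T 1 p) (c (\<alpha> + 4 * \<rho>)) + (\<alpha> + 4 * \<rho> - (\<alpha> + 2 * \<rho>)) - e \<le> dist (T 1 p) p"
    unfolding p_def
    by (rule dist_before_entry[OF c entry])
       (use \<alpha> \<rho> entry_p_forward[of 0] in \<open>auto simp: p_def\<close>)
  then show ?thesis
    using constants(1) zero_le_dist[of "T 1 p" "c (\<alpha> + 4 * \<rho>)"] dist_commute[of p "T 1 p"]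
    by linarith
qed

text \<open>For positive \<open>n\<close>, \<open>T (- 1) p\<close> and \<open>T n p\<close> lie on
  different sides of the piece, so one more step adds at least
  \<open>dist p (T 1 p) - \<rho> / 10\<close>.\<close>

lemma orbit_p: "real n * (\<rho> / 2) \<le> dist p (T (int n) p)"
proof (induction n)
  case (Suc n)
  have "dist (T (- 1) p) p + dist p (T (int n) p) - \<rho> / 10 \<le> dist (T (- 1) p) (T (int n) p)"
  proof (cases n)
    case (Suc k)
    then show ?thesis
      using crossing_p[OF entry_p_back entry_p_forward[of k]] by (simp add: add.commute)
  qed (use \<rho> in simp)
  moreover have "dist (T (- 1) p) (T (int n) p) = dist p (T (int (Suc n)) p)"
    using T_add[of 1 "int n" p] by (simp add: dist_T_swap)
  moreover have "dist (T (- 1) p) p = dist p (T 1 p)"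
    by (rule dist_T_swap)
  ultimately show ?case
    using Suc dist_p \<rho> by (simp add: algebra_simps)
qed simp

text \<open>A fixed point would keep the orbit of \<open>p\<close> bounded, but that orbit grows
  linearly.\<close>

lemma displacement_pos: "0 < dist z (T 1 z)"
proof (rule ccontr)
  assume "\<not> ?thesis"
  then have fix_z: "dist z (T (int n) z) = 0" for n
    using dist_T_le[of z n] by simp
  obtain n :: nat where "2 * dist p z / (\<rho> / 2) < real n"
    using reals_Archimedean2 by blast
  then have n: "2 * dist p z < real n * (\<rho> / 2)"
    using \<rho> by (simp add: field_simps)
  have "dist p (T (int n) p) \<le> dist p z + dist z (T (int n) z) + dist (T (int n) z) (T (int n) p)"
    using dist_triangle[of p "T (int n) p" z] dist_triangle[of z "T (int n) p" "T (int n) z"] by simp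
  then show False
    using n orbit_p[of n] fix_z[of n] by (simp add: dist_commute)
qed

text \<open>Otherwise each step of the orbit would come closer to \<open>p\<close> by a fixed amount.\<close>

lemma orbit_leaves_back: "\<exists>n. entry (T (- int n) z) < \<alpha>"
proof (rule ccontr)
  assume "\<not> ?thesis"
  then have ge: "\<alpha> \<le> entry (T (- int n) z)" for n
    by (meson not_less)
  have "dist p (T (- int n) z) + real n * (\<rho> / 2) \<le> dist p z" for n
  proof (induction n)
    case (Suc n)
    let ?y = "T (- int (Suc n)) z"
    have "T 1 (T (- int (Suc (Suc n))) z) = ?y" and y: "T 1 ?y = T (- int n) z"
      by (simp_all add: T_add[symmetric])
    then have "\<alpha> + 4 * \<rho> \<le> entry ?y"
      using nested[OF ge[of "Suc (Suc n)"]] by simp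
    then have "dist (T (- 1) p) p + dist p ?y - \<rho> / 10 \<le> dist (T (- 1) p) ?y"
      by (rule crossing_p[OF entry_p_back])
    then have "dist p (T 1 p) + dist p ?y - \<rho> / 10 \<le> dist p (T (- int n) z)"
      by (simp only: dist_T_swap y)
    moreover have "real (Suc n) * (\<rho> / 2) = real n * (\<rho> / 2) + \<rho> / 2"
      by (simp add: distrib_right)
    ultimately show ?case using Suc dist_p \<rho> by linarith
  qed simp
  moreover obtain n :: nat where "dist p z / (\<rho> / 2) < real n"
    using reals_Archimedean2 by blast
  then have "dist p z < real n * (\<rho> / 2)"
    using \<rho> by (simp add: field_simps)
  ultimately show False
    using zero_le_dist[of p "T (- int n) z"] by (smt (verit))
qed

text \<open>Mirror image of \<open>orbit_leaves_back\<close>: otherwise geodesics from the forward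
  orbit to \<open>T 1 p\<close> pass near \<open>p\<close>, and each step comes closer to
  \<open>p\<close> by at least \<open>\<rho> / 2\<close>.\<close>

lemma orbit_leaves_forward: "\<exists>n. \<alpha> + 4 * \<rho> \<le> entry (T (int n) z)"
proof (rule ccontr)
  assume "\<not> ?thesis"
  then have less: "entry (T (int n) z) < \<alpha> + 4 * \<rho>" for n
    by (meson not_less)
  have "dist p (T (int n) z) + real n * (\<rho> / 2) \<le> dist p z" for n
  proof (induction n)
    case (Suc n)
    let ?y = "T (int (Suc n)) z"
    have "T (- 1) (T (int (Suc (Suc n))) z) = ?y" and y: "?y = T 1 (T (int n) z)"
      by (simp_all add: T_add[symmetric] add.commute)
    then have "entry ?y < \<alpha>"
      using nested_back[OF less[of "Suc (Suc n)"]] by simp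
    then have "dist ?y p + dist p (T 1 p) - \<rho> / 10 \<le> dist ?y (T 1 p)"
      using crossing_p[of ?y "T 1 p"] entry_p_forward[of 0] by simp
    also have "dist ?y (T 1 p) = dist (T (int n) z) p"
      by (simp only: y T_dist)
    finally have "dist ?y p + dist p (T 1 p) - \<rho> / 10 \<le> dist (T (int n) z) p" .
    moreover have "real (Suc n) * (\<rho> / 2) = real n * (\<rho> / 2) + \<rho> / 2"
      by (simp add: distrib_right)
    ultimately show ?case
      using Suc dist_p \<rho> dist_commute[of p ?y] dist_commute[of p "T (int n) z"] by linarith
  qed simp
  moreover obtain n :: nat where "dist p z / (\<rho> / 2) < real n"
    using reals_Archimedean2 by blast
  then have "dist p z < real n * (\<rho> / 2)"
    using \<rho> by (simp add: field_simps)
  ultimately show False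
    using zero_le_dist[of p "T (int n) z"] by (smt (verit))
qed

lemma axis_passes_near:
  assumes l: "geodesic_line l" "\<And>i t. T i (l t) = l (t + of_int i * a)" and i: "i \<in> {1, 2, 3}"
  shows "\<exists>t. dist (l t) (c (\<alpha> + i * \<rho>)) \<le> \<rho> / 25"
proof -
  obtain m n where mn: "entry (T (- int n) (l 0)) < \<alpha>" "\<alpha> + 4 * \<rho> \<le> entry (T (int m) (l 0))"
    using orbit_leaves_back orbit_leaves_forward by blast
  define s t where "s = - real n * a" and "t = real m * a"
  have st: "entry (l s) < \<alpha>" "\<alpha> + 4 * \<rho> \<le> entry (l t)"
    using mn by (simp_all add: l(2) s_def t_def)
  \<comment> \<open>The sign of \<open>a\<close> is not prescribed, so the line may cross the piece
    in either direction.\<close>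
  define \<sigma> where "\<sigma> = (if s \<le> t then 1 else - 1 :: real)"
  define g where "g x = l (s + \<sigma> * x)" for x
  have d: "dist (l x) (l y) = \<bar>x - y\<bar>" for x y
    using l(1) by (simp add: geodesic_line_def isometric_on_def dist_real_def)
  have "isometric_on {0..dist (l s) (l t)} g"
    by (auto simp: isometric_on_def g_def d \<sigma>_def dist_real_def)
  moreover have "g 0 = l s" "g (dist (l s) (l t)) = l t"
    by (auto simp: g_def d \<sigma>_def)
  ultimately show ?thesis
    using crossing[OF st i, of g] unfolding g_def by blast
qed

text \<open>
  A point high above the axis in a flat half-plane would see three points of the tree-like
  geodesic, spaced by \<open>\<rho>\<close>, at nearly equal distances.
\<close>

lemma axis_not_bounds_flat_half_plane:
  assumes l: "geodesic_line l" "\<And>i t. T i (l t) = l (t + of_int i * a)"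
  shows "\<not> bounds_flat_half_plane l"
proof
  assume "bounds_flat_half_plane l"
  then obtain f :: "real^2 \<Rightarrow> 'a" where f: "isometric_on {v. 0 \<le> v $ 2} f"
    "f ` {v. v $ 2 = 0} = range l"
    unfolding bounds_flat_half_plane_def by blast
  have "\<exists>v. v $ 2 = 0 \<and> dist (f v) (c (\<alpha> + i * \<rho>)) \<le> \<rho> / 25" if i: "i \<in> {1, 2, 3}" for i
  proof -
    obtain t where t: "dist (l t) (c (\<alpha> + i * \<rho>)) \<le> \<rho> / 25"
      using axis_passes_near[OF l i] by blast
    have "l t \<in> f ` {v. v $ 2 = 0}" using f by simp
    then show ?thesis using t by auto
  qed
  then obtain v where v: "v i $ 2 = 0" "dist (f (v i)) (c (\<alpha> + i * \<rho>)) \<le> \<rho> / 25"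
    if "i \<in> {1, 2, 3}" for i :: real
    by metis
  \<comment> \<open>At this height horizontal offsets up to \<open>2 * \<rho>\<close> change the
    distance by at most \<open>\<rho> / 25\<close>.\<close>
  define V where "V = 100 * \<rho>"
  have V: "0 < V" "0 \<le> V" using \<rho> by (auto simp: V_def)
  define y where "y = v 2 + vector [0, V]"
  have y: "y $ 1 = v 2 $ 1" "y $ 2 = V" using v[of 2] by (simp_all add: y_def)
  have flat: "dist (f u) (f w) = sqrt ((u $ 1 - w $ 1)\<^sup>2 + (u $ 2 - w $ 2)\<^sup>2)"
    if "0 \<le> u $ 2" "0 \<le> w $ 2" for u w
    using f(1) that by (simp add: isometric_on_def dist_vec_def L2_set_def sum_2 dist_real_def)
  have near: "V - \<rho> / 10 \<le> dist (f y) (c (\<alpha> + i * \<rho>)) \<and>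
      dist (f y) (c (\<alpha> + i * \<rho>)) \<le> V + \<rho> / 10" if i: "i \<in> {1, 2, 3}" for i
  proof -
    define w where "w = \<bar>v 2 $ 1 - v i $ 1\<bar>"
    have "w = dist (f (v 2)) (f (v i))"
      using v[OF i] v[of 2] by (simp add: flat w_def)
    also have "\<dots> \<le> dist (f (v 2)) (c (\<alpha> + 2 * \<rho>)) + (dist (c (\<alpha> + 2 * \<rho>)) (c (\<alpha> + i * \<rho>)) +
        dist (c (\<alpha> + i * \<rho>)) (f (v i)))"
      using dist_triangle[of "f (v 2)" "f (v i)" "c (\<alpha> + 2 * \<rho>)"]
        dist_triangle[of "c (\<alpha> + 2 * \<rho>)" "f (v i)" "c (\<alpha> + i * \<rho>)"] by linarith
    also have "dist (c (\<alpha> + 2 * \<rho>)) (c (\<alpha> + i * \<rho>)) = \<bar>\<alpha> + 2 * \<rho> - (\<alpha> + i * \<rho>)\<bar>"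
      by (rule dist_c[OF c entry]) (use i \<alpha> \<rho> in auto)
    also have "\<dots> \<le> \<rho>"
      using i \<rho> by auto
    finally have w: "w \<le> 2 * \<rho>" "0 \<le> w"
      using v[OF i] v[of 2] \<rho> by (auto simp: dist_commute w_def)
    have d: "dist (f y) (f (v i)) = sqrt (w\<^sup>2 + V\<^sup>2)"
      using v[OF i] V y by (simp add: flat w_def)
    have "V \<le> dist (f y) (f (v i))"
      unfolding d by (rule real_le_rsqrt) simp
    moreover have "dist (f y) (f (v i)) \<le> V + \<rho> / 25"
      unfolding d
    proof (rule real_le_lsqrt)
      have "w\<^sup>2 \<le> (2 * \<rho>)\<^sup>2" using w by (intro power_mono) auto
      moreover have "(2 * \<rho>)\<^sup>2 = 4 * \<rho>\<^sup>2" "(V + \<rho> / 25)\<^sup>2 = V\<^sup>2 + 8 * \<rho>\<^sup>2 + \<rho>\<^sup>2 / 625"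
        by (simp_all add: V_def power2_eq_square algebra_simps)
      ultimately show "w\<^sup>2 + V\<^sup>2 \<le> (V + \<rho> / 25)\<^sup>2"
        using zero_le_power2[of \<rho>] by linarith
    qed (use V \<rho> in auto)
    ultimately show ?thesis
      using v(2)[OF i] dist_triangle[of "f y" "c (\<alpha> + i * \<rho>)" "f (v i)"]
        dist_triangle[of "f y" "f (v i)" "c (\<alpha> + i * \<rho>)"] \<rho>
      by (simp add: dist_commute)
  qed
  have in_L: "\<alpha> + 1 * \<rho> \<in> {0..L}" "\<alpha> + 2 * \<rho> \<in> {0..L}" "\<alpha> + 3 * \<rho> \<in> {0..L}"
    using \<alpha> \<rho> by auto
  \<comment> \<open>Two consecutive ones of the three points lie on the same side of the entry of
    \<open>f y\<close>, so their distances from \<open>f y\<close> differ by at least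
    \<open>\<rho> - e\<close>, while \<open>near\<close> allows only
    \<open>\<rho> / 5\<close>.\<close>
  show False
  proof (cases "entry (f y) \<le> \<alpha> + 2 * \<rho>")
    case True
    then show False
      using dist_after_entry[OF c entry in_L(2,3) True] near[of 2] near[of 3] \<rho> constants(1)
      by simp
  next
    case False
    then show False
      using dist_before_entry[OF c entry in_L(1,2), of "f y"] near[of 2] near[of 1] \<rho>
        constants(1)
      by simp
  qed
qed

text \<open>An axis through \<open>x\<close> exists because the displacement of \<open>x\<close> is
  minimal and positive. That the minimum is attained comes from the geometric action, in
  \<open>displacement_attained\<close>.\<close>

lemma rank_one:
  assumes x: "\<And>y. dist x (T 1 x) \<le> dist y (T 1 y)"
  shows "rank_one_isometry (T 1)"
proof -
  define a where "a = dist x (T 1 x)"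
  have a: "0 < a" unfolding a_def by (rule displacement_pos)
  obtain l where l: "geodesic_line l" "\<And>i t. T i (l t) = l (t + of_int i * a)"
    using axis_through[OF _ _ a, of x] x unfolding a_def by blast
  have "translation_length (T 1) = a"
    unfolding translation_length_def a_def
    by (rule antisym) (auto intro!: cINF_lower2 cINF_greatest x bdd_belowI2[of _ 0])
  moreover have "surj (T 1)"
    using T_add[of 1 "- 1"] by (metis T_0 add.right_inverse surjI)
  moreover have "axis_of (T 1) l"
    using l a unfolding axis_of_def by (intro conjI exI[of _ a]) auto
  ultimately show ?thesis
    using a axis_not_bounds_flat_half_plane[OF l]
    unfolding rank_one_isometry_def hyperbolic_isometry_def
    by (auto simp: isometric_on_def a_def)
qed

end

section \<open>Geometric actions\<close>

context
  fixes G :: "('g, 'm) monoid_scheme" (structure)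
    and \<phi> :: "'g \<Rightarrow> 'a::{cat0_space, proper_metric_space} \<Rightarrow> 'a"
  assumes geometric: "acts_geometrically G \<phi>"
begin

section \<open>Isometries, coarse transitivity and minimal displacement\<close>

lemma action: "group_action G UNIV \<phi>" and is_group: "group G"
proof -
  show "group_action G UNIV \<phi>"
    using geometric by (simp add: acts_geometrically_def)
  then show "group G"
    using group_action.group_hom group_hom.axioms(1) by blast
qed

lemma \<phi>_mult: "g \<in> carrier G \<Longrightarrow> h \<in> carrier G \<Longrightarrow> \<phi> (g \<otimes> h) x = \<phi> g (\<phi> h x)"
  by (rule group_action.composition_rule[OF action]) auto

lemma \<phi>_one: "\<phi> \<one> x = x"
  using group_action.id_eq_one[OF action] by (metis UNIV_I restrict_apply)

lemma \<phi>_inv: "g \<in> carrier G \<Longrightarrow> \<phi> (inv g) (\<phi> g x) = x"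
  by (rule group_action.orbit_sym_aux[OF action]) auto

lemma \<phi>_dist: "g \<in> carrier G \<Longrightarrow> dist (\<phi> g x) (\<phi> g y) = dist x y"
  using geometric by (auto simp: acts_geometrically_def isometric_on_def)

lemma integer_action_power:
  assumes "h \<in> carrier G"
  shows "integer_action (\<lambda>i::int. \<phi> (h [^] i))"
  by unfold_locales
    (use assms is_group in \<open>simp_all add: \<phi>_one \<phi>_mult \<phi>_dist group.int_pow_mult group.int_pow_closed\<close>)

lemma coarsely_transitive: "\<exists>R. \<forall>x y. \<exists>g\<in>carrier G. dist (\<phi> g x) y \<le> R"
proof -
  obtain K where K: "compact K" "(\<Union>g\<in>carrier G. \<phi> g ` K) = UNIV"
    using geometric by (auto simp: acts_geometrically_def cocompact_def)
  have "\<exists>g\<in>carrier G. dist (\<phi> g x) y \<le> diameter K" for x y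
  proof -
    have "x \<in> (\<Union>g\<in>carrier G. \<phi> g ` K)" "y \<in> (\<Union>g\<in>carrier G. \<phi> g ` K)"
      using K(2) by auto
    then obtain g k g' k' where g: "g \<in> carrier G" "k \<in> K" "x = \<phi> g k"
      and g': "g' \<in> carrier G" "k' \<in> K" "y = \<phi> g' k'"
      by blast
    have "inv g \<in> carrier G" using g is_group by simp
    then have "\<phi> (g' \<otimes> inv g) x = \<phi> g' k"
      using g g' by (simp add: \<phi>_mult \<phi>_inv)
    then have "dist (\<phi> (g' \<otimes> inv g) x) y = dist k k'"
      using g' by (simp add: \<phi>_dist)
    also have "\<dots> \<le> diameter K"
      using K(1) g g' by (intro diameter_bounded_bound compact_imp_bounded)
    finally show ?thesis
      using g g' is_group \<open>inv g \<in> carrier G\<close> by (meson group.is_monoid monoid.m_closed)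
  qed
  then show ?thesis by blast
qed

text \<open>
  Up to conjugation only finitely many elements displace some point of a compact fundamental set by
  a bounded amount.
\<close>

lemma displacement_attained:
  assumes h: "h \<in> carrier G"
  shows "\<exists>x. \<forall>y. dist x (\<phi> h x) \<le> dist y (\<phi> h y)"
proof -
  interpret group G by (rule is_group)
  obtain K where K: "compact K" "(\<Union>g\<in>carrier G. \<phi> g ` K) = UNIV"
    using geometric by (auto simp: acts_geometrically_def cocompact_def)
  then obtain k0 where k0: "k0 \<in> K" by auto
  obtain R where R: "\<And>k. k \<in> K \<Longrightarrow> dist k0 k \<le> R"
    using compact_imp_bounded[OF K(1)] bounded_any_center[of K k0] by blast
  define conj where "conj g = inv g \<otimes> h \<otimes> g" for g
  define a0 where "a0 = dist k0 (\<phi> h k0)"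
  \<comment> \<open>The displacement by \<open>h\<close> at a translate of \<open>k\<close> is that
    of a conjugate of \<open>h\<close> at \<open>k\<close>. So all points displaced by at most
    \<open>a0\<close> are represented in \<open>K\<close> by elements of \<open>C\<close>.\<close>
  define C where "C = {c \<in> conj ` carrier G. \<exists>k\<in>K. dist k (\<phi> c k) \<le> a0}"
  have conj_closed: "conj g \<in> carrier G" if "g \<in> carrier G" for g
    using that h by (simp add: conj_def)
  have disp: "dist k (\<phi> (conj g) k) = dist (\<phi> g k) (\<phi> h (\<phi> g k))" if g: "g \<in> carrier G" for g k
  proof -
    have "\<phi> g (\<phi> (conj g) k) = \<phi> (g \<otimes> conj g) k"
      using g by (simp add: \<phi>_mult conj_closed)
    also have "g \<otimes> conj g = h \<otimes> g"
      using g h by (simp add: conj_def m_assoc[symmetric])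
    also have "\<phi> (h \<otimes> g) k = \<phi> h (\<phi> g k)"
      using g h by (simp add: \<phi>_mult)
    finally show ?thesis
      using \<phi>_dist[OF g, of k "\<phi> (conj g) k"] by simp
  qed
  have "finite C"
  proof (rule finite_subset)
    let ?B = "cball k0 (R + a0)"
    show "C \<subseteq> {g \<in> carrier G. \<phi> g ` ?B \<inter> ?B \<noteq> {}}"
    proof
      fix c assume "c \<in> C"
      then obtain k where k: "c \<in> carrier G" "k \<in> K" "dist k (\<phi> c k) \<le> a0"
        by (auto simp: C_def conj_closed)
      have "k \<in> ?B"
        using R[OF k(2)] by (simp add: a0_def add_increasing2)
      moreover have "\<phi> c k \<in> ?B"
        using R[OF k(2)] k(3) dist_triangle[of k0 "\<phi> c k" k] by simp
      ultimately have "\<phi> c k \<in> \<phi> c ` ?B \<inter> ?B"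
        by blast
      then show "c \<in> {g \<in> carrier G. \<phi> g ` ?B \<inter> ?B \<noteq> {}}"
        using k(1) by blast
    qed
    show "finite {g \<in> carrier G. \<phi> g ` ?B \<inter> ?B \<noteq> {}}"
      using geometric compact_cball_proper
      by (auto simp: acts_geometrically_def properly_discontinuous_def)
  qed
  have "\<exists>k\<in>K. \<forall>k'\<in>K. dist k (\<phi> c k) \<le> dist k' (\<phi> c k')" if "c \<in> carrier G" for c
  proof (rule continuous_attains_inf[OF K(1)])
    have "continuous_on K (\<phi> c)"
      unfolding continuous_on_iff using \<phi>_dist[OF that] by metis
    then show "continuous_on K (\<lambda>k. dist k (\<phi> c k))"
      by (intro continuous_intros)
  qed (use k0 in auto)
  then obtain k where k: "\<And>c. c \<in> carrier G \<Longrightarrow> k c \<in> K"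
    "\<And>c k'. c \<in> carrier G \<Longrightarrow> k' \<in> K \<Longrightarrow> dist (k c) (\<phi> c (k c)) \<le> dist k' (\<phi> c k')"
    by metis
  have "conj \<one> = h" using h by (simp add: conj_def)
  then have "h \<in> C"
    unfolding C_def using k0 by (auto simp: a0_def intro!: image_eqI[of _ _ \<one>])
  define \<mu> where "\<mu> c = dist (k c) (\<phi> c (k c))" for c
  obtain c where c: "c \<in> C" "\<And>c'. c' \<in> C \<Longrightarrow> \<mu> c \<le> \<mu> c'"
    using \<open>finite C\<close> \<open>h \<in> C\<close> arg_min_if_finite[of C \<mu>] by (metis empty_iff not_le_imp_less)
  then obtain g where g: "g \<in> carrier G" "c = conj g" by (auto simp: C_def)
  have "\<mu> c \<le> dist y (\<phi> h y)" for y
  proof (cases "dist y (\<phi> h y) \<le> a0")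
    case True
    have "y \<in> (\<Union>g\<in>carrier G. \<phi> g ` K)" using K(2) by auto
    then obtain g' k' where g': "g' \<in> carrier G" "k' \<in> K" "y = \<phi> g' k'" by blast
    then have eq: "dist k' (\<phi> (conj g') k') = dist y (\<phi> h y)" by (simp add: disp)
    then have "dist k' (\<phi> (conj g') k') \<le> a0" using True by linarith
    then have "conj g' \<in> C" unfolding C_def using g' by blast
    then have "\<mu> c \<le> \<mu> (conj g')" by (rule c)
    also have "\<dots> \<le> dist y (\<phi> h y)"
      unfolding eq[symmetric] \<mu>_def using g' by (intro k conj_closed)
    finally show ?thesis .
  next
    case False
    have "\<mu> c \<le> \<mu> h" using \<open>h \<in> C\<close> by (rule c)
    also have "\<dots> \<le> a0" unfolding \<mu>_def a0_def using h k0 by (intro k)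
    finally show ?thesis using False by simp
  qed
  moreover have "\<mu> c = dist (\<phi> g (k c)) (\<phi> h (\<phi> g (k c)))"
    unfolding \<mu>_def using disp[OF g(1)] g(2) by simp
  ultimately show ?thesis by auto
qed

text \<open>
  A group element moving \<open>c 0\<close> to \<open>c t\<close> nests half-spaces unless it folds \<open>c\<close> back at \<open>c t\<close>.
  If the elements for \<open>t = 12 * \<rho>\<close> and \<open>t = 24 * \<rho>\<close> both fold, then their quotient shifts a piece
  of \<open>c\<close> along \<open>c\<close>, and then it nests half-spaces.
\<close>

lemma exists_nested:
  fixes c :: "real \<Rightarrow> 'a"
  assumes c: "isometric_on {0..24 * \<rho>} c"
    and entry: "\<And>z. entry z \<in> {0..24 * \<rho>}"
      "\<And>z v. v \<in> {0..24 * \<rho>} \<Longrightarrow> dist z (c (entry z)) + \<bar>v - entry z\<bar> - e \<le> dist z (c v)"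
    and \<rho>: "0 < \<rho>" "100000 * e \<le> \<rho>"
    and R: "\<forall>x y. \<exists>g\<in>carrier G. dist (\<phi> g x) y \<le> R" "100000 * R \<le> \<rho>"
  shows "\<exists>h\<in>carrier G. \<exists>\<alpha>\<ge>0. \<alpha> + 4 * \<rho> \<le> 24 * \<rho> \<and>
    (\<forall>z. \<alpha> \<le> entry z \<longrightarrow> \<alpha> + 4 * \<rho> \<le> entry (\<phi> h z))"
proof (rule ccontr)
  interpret group G by (rule is_group)
  assume contra: "\<not> ?thesis"
  have e: "0 \<le> e" by (rule error_nonneg[OF c entry])
  have fold: "(dist (c (t - 4 * \<rho>)) (\<phi> h (c (s + 4 * \<rho>))))\<^sup>2 \<le> 8 * (e + 2 * e1) * (4 * \<rho> + e1)"
    if h: "h \<in> carrier G" and st: "dist (\<phi> h (c s)) (c t) \<le> e1"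
      and s: "0 \<le> s" "s + 12 * \<rho> \<le> t" "t \<le> 24 * \<rho>" for h s t e1
  proof -
    \<comment> \<open>The claim fails at \<open>\<alpha> = s + 4 * \<rho>\<close>, and
      \<open>\<alpha> + 4 * \<rho>\<close> is at most \<open>t - 4 * \<rho>\<close>, as folding with
      \<open>r = 4 * \<rho>\<close> requires.\<close>
    obtain y where "s + 4 * \<rho> \<le> entry y" "entry (\<phi> h y) < s + 4 * \<rho> + 4 * \<rho>"
      using contra h s \<rho> by (fastforce simp: not_le dest: spec[of _ "s + 4 * \<rho>"])
    then show ?thesis
      by (intro fold_or_nest[OF c entry \<phi>_dist[OF h] st]) (use s \<rho> in auto)
  qed
  have fold0: "\<exists>h\<in>carrier G. dist (\<phi> h (c 0)) (c t) \<le> \<rho> / 20 \<and>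
      dist (\<phi> h (c (4 * \<rho>))) (c (t - 4 * \<rho>)) \<le> \<rho> / 20" if t: "t = 12 * \<rho> \<or> t = 24 * \<rho>" for t
  proof -
    obtain h where h: "h \<in> carrier G" "dist (\<phi> h (c 0)) (c t) \<le> R"
      using R(1) by blast
    have R0: "0 \<le> R" using h(2) zero_le_dist order_trans by blast
    have "(dist (c (t - 4 * \<rho>)) (\<phi> h (c (0 + 4 * \<rho>))))\<^sup>2 \<le> 8 * (e + 2 * R) * (4 * \<rho> + R)"
      by (rule fold[OF h]) (use t \<rho> in auto)
    also have "\<dots> \<le> (\<rho> / 4000) * (5 * \<rho>)"
      using \<rho> R(2) R0 e by (intro mult_mono) auto
    also have "\<dots> \<le> (\<rho> / 20)\<^sup>2"
      by (simp add: power2_eq_square)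
    finally have "dist (c (t - 4 * \<rho>)) (\<phi> h (c (4 * \<rho>))) \<le> \<rho> / 20"
      using \<rho> by (auto intro: power2_le_imp_le)
    then show ?thesis
      using h R(2) \<rho> R0 by (intro bexI[of _ h]) (auto simp: dist_commute)
  qed
  obtain h1 where h1: "h1 \<in> carrier G" "dist (\<phi> h1 (c 0)) (c (12 * \<rho>)) \<le> \<rho> / 20"
      "dist (\<phi> h1 (c (4 * \<rho>))) (c (12 * \<rho> - 4 * \<rho>)) \<le> \<rho> / 20"
    using fold0[OF disjI1[OF refl]] by meson
  obtain h2 where h2: "h2 \<in> carrier G" "dist (\<phi> h2 (c 0)) (c (24 * \<rho>)) \<le> \<rho> / 20"
      "dist (\<phi> h2 (c (4 * \<rho>))) (c (24 * \<rho> - 4 * \<rho>)) \<le> \<rho> / 20"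
    using fold0[OF disjI2[OF refl]] by meson
  note h = h1(1) h2(1)
  define g where "g = h2 \<otimes> inv h1"
  have g: "g \<in> carrier G" "inv h1 \<in> carrier G"
    using h by (simp_all add: g_def)
  have shift: "dist (\<phi> g (c s)) (c t) \<le> \<rho> / 10"
    if "dist (\<phi> h1 x) (c s) \<le> \<rho> / 20" "dist (\<phi> h2 x) (c t) \<le> \<rho> / 20" for x s t
  proof -
    have "\<phi> g (\<phi> h1 x) = \<phi> h2 x"
      using g h by (simp add: g_def \<phi>_mult \<phi>_inv)
    then have "dist (\<phi> g (c s)) (\<phi> h2 x) = dist (\<phi> h1 x) (c s)"
      using \<phi>_dist[OF g(1), of "c s" "\<phi> h1 x"] by (simp add: dist_commute)
    then show ?thesis
      using that dist_triangle[of "\<phi> g (c s)" "c t" "\<phi> h2 x"] by simp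
  qed
  \<comment> \<open>The images of \<open>c (4 * \<rho>)\<close> show that \<open>g\<close> moves
    \<open>c (8 * \<rho>)\<close> near \<open>c (20 * \<rho>)\<close>. Folding there would send
    \<open>c (12 * \<rho>)\<close> to within \<open>5 * \<rho>\<close> of
    \<open>c (16 * \<rho>)\<close>, but the images of \<open>c 0\<close> put it near
    \<open>c (24 * \<rho>)\<close>.\<close>
  have "dist (\<phi> g (c (8 * \<rho>))) (c (20 * \<rho>)) \<le> \<rho> / 10"
    using shift[of "c (4 * \<rho>)" "8 * \<rho>" "20 * \<rho>"] h1 h2 by simp
  then have "(dist (c (20 * \<rho> - 4 * \<rho>)) (\<phi> g (c (8 * \<rho> + 4 * \<rho>))))\<^sup>2 \<le>
      8 * (e + 2 * (\<rho> / 10)) * (4 * \<rho> + \<rho> / 10)"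
    by (rule fold[OF g(1)]) (use \<rho> in auto)
  also have "\<dots> \<le> 2 * \<rho> * (5 * \<rho>)"
    by (rule mult_mono) (use \<rho> e in auto)
  also have "\<dots> < (5 * \<rho>)\<^sup>2"
    using \<rho> by (simp add: power2_eq_square)
  finally have "(dist (c (16 * \<rho>)) (\<phi> g (c (12 * \<rho>))))\<^sup>2 < (5 * \<rho>)\<^sup>2"
    by simp
  then have "dist (c (16 * \<rho>)) (\<phi> g (c (12 * \<rho>))) < 5 * \<rho>"
    by (rule power2_less_imp_less) (use \<rho> in simp)
  moreover have "dist (\<phi> g (c (12 * \<rho>))) (c (24 * \<rho>)) \<le> \<rho> / 10"
    using h1(2) h2(2) by (rule shift)
  moreover have "dist (c (16 * \<rho>)) (c (24 * \<rho>)) = \<bar>16 * \<rho> - 24 * \<rho>\<bar>"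
    by (rule dist_c[OF c entry]) (use \<rho> in auto)
  moreover have "dist (c (16 * \<rho>)) (c (24 * \<rho>)) \<le>
      dist (c (16 * \<rho>)) (\<phi> g (c (12 * \<rho>))) + dist (\<phi> g (c (12 * \<rho>))) (c (24 * \<rho>))"
    by (rule dist_triangle)
  ultimately show False using \<rho> by simp
qed

lemma rank_one_of_tree_like:
  fixes b :: "real \<Rightarrow> 'a"
  assumes b: "geodesic_ray b"
    and tree_like: "\<And>\<epsilon> M. 0 < \<epsilon> \<Longrightarrow> \<exists>L\<ge>M. 0 < L \<and> tree_like b L (\<epsilon> * L)"
  shows "\<exists>g\<in>carrier G. rank_one_isometry (\<phi> g)"
proof -
  obtain R where R: "\<forall>x y. \<exists>g\<in>carrier G. dist (\<phi> g x) y \<le> R"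
    using coarsely_transitive by blast
  \<comment> \<open>With \<open>\<rho> = L / 24\<close> this makes both \<open>e\<close> and
    \<open>R\<close> at most \<open>\<rho> / 100000\<close>.\<close>
  obtain L where L: "2400000 * R \<le> L" "0 < L" "tree_like b L (1 / 2400000 * L)"
    using tree_like[of "1 / 2400000" "2400000 * R"] by auto
  define \<rho> e where "\<rho> = L / 24" and "e = 1 / 2400000 * L"
  have \<rho>: "0 < \<rho>" "100000 * e \<le> \<rho>" "100000 * R \<le> \<rho>" "L = 24 * \<rho>"
    using L by (auto simp: \<rho>_def e_def)
  have c: "isometric_on {0..24 * \<rho>} b"
    using b by (auto simp: geodesic_ray_def isometric_on_def)
  obtain entry where entry: "\<And>z. entry z \<in> {0..24 * \<rho>}"
    "\<And>z v. v \<in> {0..24 * \<rho>} \<Longrightarrow> dist z (b (entry z)) + \<bar>v - entry z\<bar> - e \<le> dist z (b v)"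
    using L(3) unfolding tree_like_def e_def \<rho>(4)[symmetric] by metis
  obtain h \<alpha> where h: "h \<in> carrier G" and \<alpha>: "0 \<le> \<alpha>" "\<alpha> + 4 * \<rho> \<le> 24 * \<rho>"
    and nested: "\<And>z. \<alpha> \<le> entry z \<Longrightarrow> \<alpha> + 4 * \<rho> \<le> entry (\<phi> h z)"
    using exists_nested[OF c entry \<rho>(1,2) R \<rho>(3)] by blast
  have h1: "h [^] (1::int) = h"
    using is_group h by (rule group.int_pow_1)
  interpret integer_action "\<lambda>i::int. \<phi> (h [^] i)"
    by (rule integer_action_power[OF h])
  interpret nested_half_spaces "\<lambda>i::int. \<phi> (h [^] i)" b "24 * \<rho>" e entry \<alpha> \<rho>
    by unfold_locales (use c entry \<rho> \<alpha> nested h1 in auto)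
  obtain x where x: "\<And>y. dist x (\<phi> h x) \<le> dist y (\<phi> h y)"
    using displacement_attained[OF h] by blast
  have "rank_one_isometry (\<phi> (h [^] (1::int)))"
    by (rule rank_one[of x]) (simp add: x h1)
  then show ?thesis
    using h h1 by auto
qed

end

theorem corollary3:
  fixes G :: "('g, 'm) monoid_scheme"
    and \<phi> :: "'g \<Rightarrow> 'a::{cat0_space, proper_metric_space} \<Rightarrow> 'a"
  assumes "acts_geometrically G \<phi>"
    and "\<exists>b :: real \<Rightarrow> 'a. geodesic_ray b \<and> sublinearly_contracting b"
  shows "\<exists>g\<in>carrier G. rank_one_isometry (\<phi> g)"
proof -
  obtain b :: "real \<Rightarrow> 'a" and \<kappa> n where b: "geodesic_ray b" "0 \<le> n" "sublinear \<kappa>"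
    "\<forall>x r. ball x r \<inter> b ` {0..} = {} \<longrightarrow>
      diameter (nearest_point (b ` {0..}) ` ball x r) \<le> n * \<kappa> (dist x (b 0))"
    using assms(2) by (auto simp: sublinearly_contracting_def kappa_contracting_def)
  show ?thesis
    by (rule rank_one_of_tree_like[OF assms(1) b(1) ray_tree_like[OF b]])
qed

end
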